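(* Let $F$ be an order continuous Banach lattice, $H$ a Banach space and $T:F\to H$ a bounded linear operator. The following are equivalent: (i) $T$ is DNS; (ii) $T$ is $\infty$-DNS; (iii) $T$ is $n$-DNS for some $n\in\mathbb{N}$, $n\ge 2$; (iv) $T$ complements $\tau_F$; (iv$'$) $T$ sequentially complements $\tau_F$.
   Context: $\mathrm{S}_F$ denotes the unit sphere of $F$; $f,g$ are disjoint if $|f|\wedge|g|=0$. A bounded operator $S$ is strictly singular if it is not bounded below on any infinite-dimensional subspace. $T$ is DNS (disjointly non-singular) if for every disjoint sequence $(f_n)$ of nonzero vectors of $F$, the restriction of $T$ to $\overline{\mathrm{span}}\{f_n\}$ is not strictly singular (equivalently, as is known, there is no disjoint sequence $(f_n)\subset\mathrm{S}_F$ with $\|Tf_n\|\to0$). For $n\in\{2,3,\dots\}$, $T$ is $n$-DNS if there is $r>0$ such that there is no pairwise disjoint $n$-tuple $f_1,\dots,f_n\in\mathrm{S}_F$ with $\|Tf_k\|\le r$ for all $k$; $T$ is $\infty$-DNS if there is $r>0$ such that $\liminf_n\|Tf_n\|>r$ for every disjoint sequence $(f_n)\subset\mathrm{S}_F$. The unbounded norm (un-) topology on $F$ is the linear topology with base of zero neighborhoods $\{f\in F:\||f|\wedge h\|<\varepsilon\}$, $h\in F_+$, $\varepsilon>0$. For order continuous $F$, $\tau_F$ denotes the un-topology (which is the weakest Hausdorff order continuous locally solid topology on $F$, and coincides with the unbounded absolute weak topology). For a linear topology $\tau$ on $F$, $T$ complements $\tau$ if there is no net $(f_p)\subset\mathrm{S}_F$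 which is $\tau$-null and satisfies $\|Tf_p\|\to0$; $T$ sequentially complements $\tau$ if the same holds for sequences. *)

theory Defs
  imports "HOL-Analysis.Analysis"
begin

definition labs :: "'a::{ordered_real_vector, lattice} \<Rightarrow> 'a" where
  "labs x = sup x (- x)"

definition banach_lattice :: "'a::{banach, ordered_real_vector, lattice} itself \<Rightarrow> bool" where
  "banach_lattice _ \<longleftrightarrow> (\<forall>x y::'a. labs x \<le> labs y \<longrightarrow> norm x \<le> norm y)"

text \<open>Order continuity: every downward directed set D with infimum 0 satisfies
  inf of norms = 0 (equivalently, every net decreasing to 0 is norm null).\<close>
definition order_continuous :: "'a::{banach, ordered_real_vector, lattice} itself \<Rightarrow> bool" where
  "order_continuous _ \<longleftrightarrow>
     (\<forall>D::'a set. D \<noteq> {} \<and> (\<forall>x\<in>D. \<forall>y\<in>D. \<exists>z\<in>D. z \<le> x \<and> z \<le> y)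
        \<and> (\<forall>d\<in>D. 0 \<le> d) \<and> (\<forall>l. (\<forall>d\<in>D. l \<le> d) \<longrightarrow> l \<le> 0)
        \<longrightarrow> (INF d\<in>D. norm d) = 0)"

definition ldisjoint :: "'a::{ordered_real_vector, lattice} \<Rightarrow> 'a \<Rightarrow> bool" where
  "ldisjoint f g \<longleftrightarrow> inf (labs f) (labs g) = 0"

definition disjoint_seq :: "(nat \<Rightarrow> 'a::{ordered_real_vector, lattice}) \<Rightarrow> bool" where
  "disjoint_seq f \<longleftrightarrow> (\<forall>i j. i \<noteq> j \<longrightarrow> ldisjoint (f i) (f j))"

definition strictly_singular_on :: "'a::real_normed_vector set \<Rightarrow> ('a \<Rightarrow> 'b::real_normed_vector) \<Rightarrow> bool" where
  "strictly_singular_on X S \<longleftrightarrow>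
     (\<forall>Y. subspace Y \<and> Y \<subseteq> X \<and> (\<exists>B\<subseteq>Y. independent B \<and> infinite B) \<longrightarrow>
        (\<forall>c>0. \<exists>y\<in>Y. norm (S y) < c * norm y))"

definition DNS :: "('a::{banach, ordered_real_vector, lattice} \<Rightarrow> 'b::banach) \<Rightarrow> bool" where
  "DNS T \<longleftrightarrow> (\<forall>f. disjoint_seq f \<and> (\<forall>n. f n \<noteq> 0) \<longrightarrow>
      \<not> strictly_singular_on (closure (span (range f))) T)"

definition nDNS :: "nat \<Rightarrow> ('a::{banach, ordered_real_vector, lattice} \<Rightarrow> 'b::banach) \<Rightarrow> bool" where
  "nDNS n T \<longleftrightarrow> (\<exists>r>0. \<not> (\<exists>f::nat \<Rightarrow> 'a.
      (\<forall>i<n. \<forall>j<n. i \<noteq> j \<longrightarrow> ldisjoint (f i) (f j)) \<and>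
      (\<forall>k<n. norm (f k) = 1 \<and> norm (T (f k)) \<le> r)))"

definition infDNS :: "('a::{banach, ordered_real_vector, lattice} \<Rightarrow> 'b::banach) \<Rightarrow> bool" where
  "infDNS T \<longleftrightarrow> (\<exists>r>0. \<forall>f. disjoint_seq f \<and> (\<forall>n. norm (f n) = 1) \<longrightarrow>
      liminf (\<lambda>n. ereal (norm (T (f n)))) > ereal r)"

definition un_null :: "('i \<Rightarrow> 'a::{banach, ordered_real_vector, lattice}) \<Rightarrow> 'i filter \<Rightarrow> bool" where
  "un_null f F \<longleftrightarrow> (\<forall>h. 0 \<le> h \<longrightarrow> (\<forall>\<epsilon>>0. eventually (\<lambda>p. norm (inf (labs (f p)) h) < \<epsilon>) F))"

text \<open>Nets are represented by a map f and a proper filter F on the index set;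
  the index set is taken to be the space itself, which suffices to represent
  every net (via its image).\<close>
definition complements_un :: "('a::{banach, ordered_real_vector, lattice} \<Rightarrow> 'b::banach) \<Rightarrow> bool" where
  "complements_un T \<longleftrightarrow> \<not> (\<exists>(f::'a \<Rightarrow> 'a) F. F \<noteq> bot \<and> (\<forall>p. norm (f p) = 1) \<and>
      un_null f F \<and> ((\<lambda>p. norm (T (f p))) \<longlongrightarrow> 0) F)"

definition seq_complements_un :: "('a::{banach, ordered_real_vector, lattice} \<Rightarrow> 'b::banach) \<Rightarrow> bool" where
  "seq_complements_un T \<longleftrightarrow> \<not> (\<exists>f::nat \<Rightarrow> 'a. (\<forall>n. norm (f n) = 1) \<and>
      un_null f sequentially \<and> (\<lambda>n. norm (T (f n))) \<longlonglongrightarrow> 0)"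

end

theory Submission
  imports Defs
begin

text \<open>The hinge is the following smallness condition: for all \<open>h \<ge> 0\<close> and \<open>\<epsilon> > 0\<close> there is a unit vector \<open>x\<close>
  with \<open>\<parallel>|x| \<and> h\<parallel> < \<epsilon>\<close> and \<open>\<parallel>T x\<parallel> < \<epsilon>\<close>. An un-null net of unit vectors with \<open>T x \<rightarrow> 0\<close> yields it
  immediately. If \<open>T\<close> is \<open>n\<close>-DNS for no \<open>n\<close>, it follows from uniform exhaustivity: an order interval
  \<open>[0,h]\<close> of an order continuous Banach lattice contains only boundedly many disjoint vectors of norm at
  least \<open>\<epsilon>\<close>. Conversely, the condition yields by a Kadec--Pelczynski argument a disjoint sequence of unit
  vectors on which \<open>T\<close> tends to zero, which is the sequential form of the failure of DNS. Such a sequence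
  is itself un-null, because disjoint order bounded sequences converge to zero, so it also violates
  the remaining conditions.\<close>

section \<open>Hahn--Banach\<close>

text \<open>For positive multiples only an inequality is demanded, which infima of families satisfy
  directly; applied to \<open>1 / t\<close> it gives equality.\<close>

definition sublinear_functional :: "('a::real_vector \<Rightarrow> real) \<Rightarrow> bool" where
  "sublinear_functional p \<longleftrightarrow>
     (\<forall>x y. p (x + y) \<le> p x + p y) \<and> (\<forall>t>0. \<forall>x. p (t *\<^sub>R x) \<le> t * p x)"

lemma sublinear_add: "sublinear_functional p \<Longrightarrow> p (x + y) \<le> p x + p y"
  by (simp add: sublinear_functional_def)

lemma sublinear_scaleR:
  assumes "sublinear_functional p" "0 < t"
  shows "p (t *\<^sub>R x) = t * p x"
proof (rule antisym)
  show "p (t *\<^sub>R x) \<le> t * p x"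
    using assms by (simp add: sublinear_functional_def)
  have "p ((1 / t) *\<^sub>R (t *\<^sub>R x)) \<le> (1 / t) * p (t *\<^sub>R x)"
    using assms unfolding sublinear_functional_def by (meson zero_less_divide_1_iff)
  then show "t * p x \<le> p (t *\<^sub>R x)"
    using assms(2) by (simp add: field_simps)
qed

lemma sublinear_0: "sublinear_functional p \<Longrightarrow> p 0 = 0"
  using sublinear_scaleR[of p 2 0] by simp

lemma sublinear_ge: "sublinear_functional p \<Longrightarrow> - p (- x) \<le> p x"
  using sublinear_add[of p x "- x"] sublinear_0[of p] by simp

text \<open>The functional is the infimum over \<open>t \<ge> 0\<close> of \<open>q\<close> shifted
  by \<open>t\<close> times \<open>a\<close>, minus \<open>t * q a\<close>. The values
  \<open>t = 0\<close> and \<open>t = 1\<close> give the last two conclusions; the second of them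
  makes \<open>q\<close> additive once \<open>q\<close> is minimal, since then
  \<open>r = q\<close>.\<close>

lemma sublinear_directional_minorant:
  fixes q :: "'a::real_vector \<Rightarrow> real"
  assumes q: "sublinear_functional q"
  obtains r where "sublinear_functional r" "r \<le> q" "\<And>x. r x \<le> q (x + a) - q a"
proof
  define S where "S x = (\<lambda>t. q (x + t *\<^sub>R a) - t * q a) ` {0..}" for x
  define r where "r x = Inf (S x)" for x
  have "- q (- x) \<le> q (x + t *\<^sub>R a) - t * q a" if "t \<ge> 0" for x t
  proof -
    have "t * q a = q (t *\<^sub>R a)"
      using that sublinear_scaleR[OF q, of t a] sublinear_0[OF q] by (cases "t = 0") auto
    then show ?thesis
      using sublinear_add[OF q, of "x + t *\<^sub>R a" "- x"] by simp
  qed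
  then have bdd: "bdd_below (S x)" for x
    by (auto simp: S_def intro!: bdd_belowI)
  have le: "r x \<le> q (x + t *\<^sub>R a) - t * q a" if "t \<ge> 0" for x t
    unfolding r_def using that by (intro cInf_lower bdd) (auto simp: S_def)
  have ge: "b \<le> r x" if "\<And>t. t \<ge> 0 \<Longrightarrow> b \<le> q (x + t *\<^sub>R a) - t * q a" for b x
    unfolding r_def using that by (intro cInf_greatest) (auto simp: S_def)
  \<comment> \<open>The parameters add: \<open>s + t\<close> is admissible for \<open>x + y\<close>.
    The infima over \<open>t\<close> and over \<open>s\<close> are then taken one after the
    other.\<close>
  have "r (x + y) - (q (x + s *\<^sub>R a) - s * q a) \<le> q (y + t *\<^sub>R a) - t * q a"
    if "s \<ge> 0" "t \<ge> 0" for x y s t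
    using le[of "s + t" "x + y"] that sublinear_add[OF q, of "x + s *\<^sub>R a" "y + t *\<^sub>R a"]
    by (simp add: algebra_simps)
  then have "r (x + y) - (q (x + s *\<^sub>R a) - s * q a) \<le> r y" if "s \<ge> 0" for x y s
    using that ge by blast
  then have "r (x + y) - r y \<le> r x" for x y
    by (intro ge) (simp add: algebra_simps)
  moreover have "r (c *\<^sub>R x) \<le> c * r x" if "c > 0" for c x
  proof -
    have "r (c *\<^sub>R x) / c \<le> q (x + t *\<^sub>R a) - t * q a" if "t \<ge> 0" for t
    proof -
      have "r (c *\<^sub>R x) \<le> q (c *\<^sub>R (x + t *\<^sub>R a)) - (c * t) * q a"
        using le[of "c * t" "c *\<^sub>R x"] \<open>c > 0\<close> that by (simp add: scaleR_add_right)
      then show ?thesis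
        using \<open>c > 0\<close> unfolding sublinear_scaleR[OF q \<open>c > 0\<close>] by (simp add: field_simps)
    qed
    then have "r (c *\<^sub>R x) / c \<le> r x"
      by (rule ge)
    then show ?thesis
      using that by (simp add: field_simps)
  qed
  ultimately show "sublinear_functional r"
    by (auto simp: sublinear_functional_def algebra_simps)
  show "r \<le> q"
    using le[of 0] by (auto simp: le_fun_def)
  show "r x \<le> q (x + a) - q a" for x
    using le[of 1] by simp
qed

text \<open>A minimal sublinear functional is linear.\<close>

lemma ex_linear_le_sublinear:
  fixes p :: "'a::real_vector \<Rightarrow> real"
  assumes p: "sublinear_functional p"
  obtains \<phi> where "linear \<phi>" "\<phi> \<le> p"
proof -
  define A where "A = {q. sublinear_functional q \<and> q \<le> p}"
  \<comment> \<open>The order is reversed, so that the maximal element from Zorn's lemma is a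
    minimal sublinear functional.\<close>
  have "partial_order_on A (relation_of (\<lambda>q r. r \<le> q) A)"
    by (auto simp: partial_order_on_def preorder_on_def refl_on_def trans_on_def antisym_on_def
        relation_of_def)
  moreover have "\<exists>u\<in>A. \<forall>q\<in>C. u \<le> q" if C: "C \<in> Chains (relation_of (\<lambda>q r. r \<le> q) A)" for C
  proof (cases "C = {}")
    case True
    then show ?thesis
      using p by (auto simp: A_def)
  next
    case False
    have CA: "C \<subseteq> A"
      using Chains_relation_of[OF C] .
    have chain: "q \<le> r \<or> r \<le> q" if "q \<in> C" "r \<in> C" for q r
      using C that by (auto simp: Chains_def relation_of_def)
    define u where "u x = Inf ((\<lambda>q. q x) ` C)" for x
    \<comment> \<open>This lower bound is common to the whole chain, so the pointwise infimum
      \<open>u\<close> is a genuine one.\<close>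
    have "- p (- x) \<le> q x" if "q \<in> C" for q x
      using that CA sublinear_ge[of q x] unfolding A_def le_fun_def
      by (smt (verit) mem_Collect_eq subsetD)
    then have le: "u x \<le> q x" if "q \<in> C" for q x
      unfolding u_def using that by (intro cInf_lower) (auto intro!: bdd_belowI)
    have ge: "b \<le> u x" if "\<And>q. q \<in> C \<Longrightarrow> b \<le> q x" for b x
      unfolding u_def using that False by (intro cInf_greatest) auto
    have "u (x + y) - q x \<le> r y" if qr: "q \<in> C" "r \<in> C" for q r x y
    proof -
      \<comment> \<open>Comparability puts one \<open>s\<close> of the chain below both
        \<open>q\<close> and \<open>r\<close>, so the subadditivity of a single functional
        suffices.\<close>
      obtain s where "s \<in> C" "s \<le> q" "s \<le> r"
        using chain[OF qr] qr by blast
      then have "u (x + y) \<le> s x + s y"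
        using le[of s "x + y"] CA sublinear_add[of s x y] unfolding A_def by fastforce
      then show ?thesis
        using \<open>s \<le> q\<close> \<open>s \<le> r\<close> unfolding le_fun_def by (smt (verit))
    qed
    then have "u (x + y) - q x \<le> u y" if "q \<in> C" for q x y
      using that ge by blast
    then have "u (x + y) - u y \<le> u x" for x y
      by (intro ge) (simp add: algebra_simps)
    moreover have "u (t *\<^sub>R x) \<le> t * u x" if "t > 0" for t x
    proof -
      have "u (t *\<^sub>R x) / t \<le> q x" if "q \<in> C" for q
        using le[OF that, of "t *\<^sub>R x"] sublinear_scaleR[of q t x] CA that \<open>t > 0\<close>
        by (auto simp: A_def field_simps)
      then have "u (t *\<^sub>R x) / t \<le> u x"
        by (rule ge)
      then show ?thesis
        using that by (simp add: field_simps)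
    qed
    ultimately have "sublinear_functional u"
      by (auto simp: sublinear_functional_def algebra_simps)
    moreover obtain q where "q \<in> C"
      using False by blast
    then have "u \<le> p"
      using le[of q] CA by (auto simp: A_def le_fun_def intro: order_trans)
    ultimately show ?thesis
      using le by (auto simp: A_def le_fun_def)
  qed
  ultimately obtain q where "q \<in> A" and min: "\<And>r. r \<in> A \<Longrightarrow> r \<le> q \<Longrightarrow> r = q"
    using predicate_Zorn[of A "\<lambda>q r. r \<le> q"] by blast
  then have q: "sublinear_functional q" "q \<le> p"
    by (auto simp: A_def)
  have add: "q (x + a) = q x + q a" for x a
  proof -
    obtain r where r: "sublinear_functional r" "r \<le> q" "\<And>x. r x \<le> q (x + a) - q a"
      using sublinear_directional_minorant[OF q(1)] by blast
    then have "r = q"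
      using min q(2) by (auto simp: A_def)
    then show ?thesis
      using r(3)[of x] sublinear_add[OF q(1), of x a] by simp
  qed
  have neg: "q (- x) = - q x" for x
    using add[of x "- x"] sublinear_0[OF q(1)] by simp
  have "q (t *\<^sub>R x) = t * q x" for t x
    using sublinear_scaleR[OF q(1), of t x] sublinear_scaleR[OF q(1), of "- t" x]
      sublinear_0[OF q(1)] neg[of "t *\<^sub>R x"]
    by (cases t "0::real" rule: linorder_cases) auto
  then have "linear q"
    by (intro linearI) (auto simp: add)
  then show thesis
    using q(2) that by blast
qed

text \<open>The minorant \<open>r\<close> of \<open>p\<close> in direction \<open>z\<close>
  satisfies \<open>r (- z) \<le> - p z\<close>, so every linear functional below \<open>r\<close> is
  at least \<open>p z\<close> at \<open>z\<close>.\<close>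

lemma hahn_banach_sublinear:
  fixes p :: "'a::real_vector \<Rightarrow> real"
  assumes "sublinear_functional p"
  obtains \<phi> where "linear \<phi>" "\<And>x. \<phi> x \<le> p x" "\<phi> z = p z"
proof -
  obtain r where r: "sublinear_functional r" "r \<le> p" "\<And>x. r x \<le> p (x + z) - p z"
    using sublinear_directional_minorant[OF assms] by blast
  obtain \<phi> where \<phi>: "linear \<phi>" "\<phi> \<le> r"
    using ex_linear_le_sublinear[OF r(1)] .
  have le: "\<phi> x \<le> p x" for x
    using \<phi>(2) r(2) by (meson le_funD order_trans)
  have "- \<phi> z \<le> - p z"
    using le_funD[OF \<phi>(2), of "- z"] r(3)[of "- z"] sublinear_0[OF assms] linear_neg[OF \<phi>(1), of z]
    by simp
  then show thesis
    using that[OF \<phi>(1) le] le[of z] by auto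
qed

section \<open>Vector lattices\<close>

lemma add_sup_left: "a + sup b c = sup (a + b) (a + (c::'a::{ordered_real_vector, lattice}))"
proof (rule antisym)
  have "sup b c \<le> sup (a + b) (a + c) - a"
    by (rule sup_least) (simp_all add: le_diff_eq add.commute)
  then show "a + sup b c \<le> sup (a + b) (a + c)"
    by (simp add: le_diff_eq add.commute)
qed simp

lemma neg_sup: "- sup a b = inf (- a) (- (b::'a::{ordered_real_vector, lattice}))"
proof (rule antisym)
  have "sup a b \<le> - inf (- a) (- b)"
    by (rule sup_least; subst le_minus_iff) simp_all
  then show "inf (- a) (- b) \<le> - sup a b"
    by (subst le_minus_iff)
qed simp

lemma neg_inf: "- inf a b = sup (- a) (- (b::'a::{ordered_real_vector, lattice}))"
  using neg_sup[of "- a" "- b"] by (simp add: minus_equation_iff)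

lemma add_inf_left: "a + inf b c = inf (a + b) (a + (c::'a::{ordered_real_vector, lattice}))"
proof -
  have "- (a + inf b c) = - inf (a + b) (a + c)"
    using add_sup_left[of "- a" "- b" "- c"] by (simp add: neg_inf)
  then show ?thesis
    by (metis minus_equation_iff)
qed

lemma sup_diff_right: "sup a b - c = sup (a - c) ((b::'a::{ordered_real_vector, lattice}) - c)"
  using add_sup_left[of "- c" a b] by simp

lemma diff_inf_left: "c - inf a b = sup (c - a) (c - (b::'a::{ordered_real_vector, lattice}))"
  by (simp only: diff_conv_add_uminus neg_inf add_sup_left)

lemma inf_plus_sup: "inf a b + sup a b = a + (b::'a::{ordered_real_vector, lattice})"
proof -
  have "a + b - inf a b = sup a b"
    by (simp add: diff_inf_left sup.commute)
  then show ?thesis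
    by (metis diff_add_cancel add.commute)
qed

text \<open>The left side lies below both \<open>b + inf a c\<close> and \<open>a + inf a c\<close>;
  by translation invariance the infimum of these two bounds is the right side. This makes
  disjointness stable under sums.\<close>

lemma inf_add_le:
  fixes a b c :: "'a::{ordered_real_vector, lattice}"
  assumes "0 \<le> a" "0 \<le> b" "0 \<le> c"
  shows "inf a (b + c) \<le> inf a b + inf a c"
proof -
  have "inf a (b + c) \<le> b + inf a c"
    using assms by (auto simp: add_inf_left intro: le_infI1 le_infI2 add_increasing)
  moreover have "inf a (b + c) \<le> a + inf a c"
    using assms by (auto simp: add_inf_left intro!: le_infI1 intro: add_increasing add_increasing2)
  ultimately have "inf a (b + c) \<le> inf (inf a c + a) (inf a c + b)"
    by (simp add: add.commute)
  then show ?thesis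
    unfolding add_inf_left[symmetric] by (simp only: add.commute)
qed

text \<open>Both multiples are dominated using the common factor \<open>r = 1 + s + t\<close>, by
  which one can divide; the summand 1 keeps it positive when \<open>s = t = 0\<close>.\<close>

lemma inf_scaleR_eq_0:
  fixes a b :: "'a::{ordered_real_vector, lattice}"
  assumes "inf a b = 0" "0 \<le> s" "0 \<le> t"
  shows "inf (s *\<^sub>R a) (t *\<^sub>R b) = 0"
proof (rule antisym)
  have ab: "0 \<le> a" "0 \<le> b"
    using assms(1) by (metis inf.cobounded1, metis inf.cobounded2)
  then show "0 \<le> inf (s *\<^sub>R a) (t *\<^sub>R b)"
    using assms by (simp add: scaleR_nonneg_nonneg)
  define r where "r = 1 + s + t"
  have r: "r > 0" "s \<le> r" "t \<le> r"
    using assms by (auto simp: r_def)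
  have "inf (s *\<^sub>R a) (t *\<^sub>R b) \<le> r *\<^sub>R a" "inf (s *\<^sub>R a) (t *\<^sub>R b) \<le> r *\<^sub>R b"
    using ab r by (auto intro: le_infI1 le_infI2 scaleR_right_mono)
  then have "(1 / r) *\<^sub>R inf (s *\<^sub>R a) (t *\<^sub>R b) \<le> inf a b"
    using r(1) by (simp add: pos_divideR_le_eq[symmetric] divide_inverse)
  then have "r *\<^sub>R (1 / r) *\<^sub>R inf (s *\<^sub>R a) (t *\<^sub>R b) \<le> r *\<^sub>R 0"
    using r(1) unfolding assms(1) by (intro scaleR_left_mono) auto
  then show "inf (s *\<^sub>R a) (t *\<^sub>R b) \<le> 0"
    using r(1) by simp
qed

lemma inf_pos_neg_part: "inf (sup x 0) (sup (- x) (0::'a::{ordered_real_vector, lattice})) = 0"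
proof -
  have "sup x 0 = x + sup (- x) 0"
    by (simp add: add_sup_left sup.commute)
  then have "inf (sup x 0) (sup (- x) 0) = inf (sup (- x) 0 + x) (sup (- x) 0 + 0)"
    by (simp add: add.commute)
  also have "\<dots> = sup (- x) 0 + inf x 0"
    by (simp only: add_inf_left)
  also have "inf x 0 = - sup (- x) 0"
    by (simp add: neg_sup)
  finally show ?thesis
    by simp
qed

text \<open>With \<open>x = u - c w\<close>, the two vectors are the positive part of
  \<open>x\<close> and \<open>1 / c\<close> times its negative part. This is how disjoint vectors
  are manufactured later.\<close>

lemma inf_sup_diff_scaled_eq_0:
  fixes u w :: "'a::{ordered_real_vector, lattice}"
  assumes "0 < c"
  shows "inf (sup (u - c *\<^sub>R w) 0) (sup (w - (1 / c) *\<^sub>R u) 0) = 0"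
proof -
  define x where "x = u - c *\<^sub>R w"
  have *: "w - (1 / c) *\<^sub>R u = (1 / c) *\<^sub>R (- x)"
    using assms by (simp add: x_def scaleR_right_diff_distrib)
  have "sup (w - (1 / c) *\<^sub>R u) 0 \<le> (1 / c) *\<^sub>R sup (- x) 0"
    unfolding * using assms by (auto intro!: scaleR_left_mono scaleR_nonneg_nonneg simp del: scaleR_minus_right)
  moreover have "inf (1 *\<^sub>R sup x 0) ((1 / c) *\<^sub>R sup (- x) 0) = 0"
    using assms by (intro inf_scaleR_eq_0 inf_pos_neg_part) auto
  ultimately have "inf (sup x 0) (sup (w - (1 / c) *\<^sub>R u) 0) \<le> 0"
    by (metis inf_mono order_refl scaleR_one)
  then show ?thesis
    unfolding x_def[symmetric] by (intro antisym) auto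
qed

lemma inf_eq_0_mono:
  fixes a b :: "'a::{ordered_real_vector, lattice}"
  assumes "inf a b = 0" "0 \<le> x" "x \<le> a" "0 \<le> y" "y \<le> b"
  shows "inf x y = 0"
  using assms by (intro antisym) (auto simp: inf_mono[of x a y b, simplified assms(1)])

section \<open>Modulus, disjointness and truncation\<close>

lemma le_labs: "x \<le> labs x" and neg_le_labs: "- x \<le> labs x"
  by (simp_all add: labs_def)

lemma neg_labs_le: "- labs x \<le> x"
  using neg_le_labs[of x] by (simp add: minus_le_iff)

lemma labs_least: "x \<le> b \<Longrightarrow> - x \<le> b \<Longrightarrow> labs x \<le> b"
  by (simp add: labs_def)

lemma labs_nonneg [simp]: "0 \<le> labs x"
proof -
  have "0 \<le> labs x + labs x"
    using add_mono[OF le_labs[of x] neg_le_labs[of x]] by simp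
  then have "0 \<le> (1 / 2) *\<^sub>R (labs x + labs x)"
    by (intro scaleR_nonneg_nonneg) auto
  then show ?thesis
    by (simp only: scaleR_half_double)
qed

lemma labs_minus [simp]: "labs (- x) = labs x"
  by (simp add: labs_def sup.commute)

lemma labs_of_nonneg: "0 \<le> x \<Longrightarrow> labs x = x"
  by (simp add: labs_def sup_absorb1 order_trans[of "- x" 0])

lemma labs_0 [simp]: "labs 0 = 0"
  by (simp add: labs_of_nonneg)

lemma labs_eq_0: "labs x = 0 \<Longrightarrow> x = 0"
  by (metis le_labs neg_le_labs neg_le_0_iff_le antisym)

lemma labs_add_le: "labs (x + y) \<le> labs x + labs y"
  using add_mono[OF neg_le_labs[of x] neg_le_labs[of y]]
  by (intro labs_least add_mono le_labs) simp

lemma labs_scaleR_le: "labs (c *\<^sub>R x) \<le> \<bar>c\<bar> *\<^sub>R labs x"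
proof -
  have *: "a *\<^sub>R x \<le> \<bar>a\<bar> *\<^sub>R labs x" for a
  proof (cases "0 \<le> a")
    case False
    then show ?thesis
      using scaleR_left_mono[OF neg_le_labs[of x], of "- a"] by simp
  qed (simp add: scaleR_left_mono le_labs)
  show ?thesis
    using *[of c] *[of "- c"] by (intro labs_least) auto
qed

lemma ldisjoint_sym: "ldisjoint f g \<longleftrightarrow> ldisjoint g f"
  by (simp add: ldisjoint_def inf.commute)

lemma ldisjoint_self: "ldisjoint f f \<Longrightarrow> f = 0"
  by (simp add: ldisjoint_def labs_eq_0)

text \<open>That a disjoint complement is a subspace carries disjointness from generators over to
  spans.\<close>

lemma subspace_ldisjoint: "subspace {x. ldisjoint x g}"
proof (rule subspaceI)
  fix x y assume "x \<in> {x. ldisjoint x g}" "y \<in> {x. ldisjoint x g}"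
  then have xy: "inf (labs g) (labs x) = 0" "inf (labs g) (labs y) = 0"
    by (simp_all add: ldisjoint_def inf.commute)
  have "inf (labs g) (labs (x + y)) \<le> inf (labs g) (labs x + labs y)"
    by (intro inf_mono order_refl labs_add_le)
  also have "\<dots> \<le> 0"
    using inf_add_le[of "labs g" "labs x" "labs y"] xy by simp
  finally show "x + y \<in> {x. ldisjoint x g}"
    by (simp add: ldisjoint_def inf.commute antisym)
next
  fix c x assume "x \<in> {x. ldisjoint x g}"
  then have "inf (\<bar>c\<bar> *\<^sub>R labs x) (1 *\<^sub>R labs g) = 0"
    by (intro inf_scaleR_eq_0) (auto simp: ldisjoint_def)
  then have "inf (labs (c *\<^sub>R x)) (labs g) = 0"
    by (rule inf_eq_0_mono) (auto simp: labs_scaleR_le)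
  then show "c *\<^sub>R x \<in> {x. ldisjoint x g}"
    by (simp add: ldisjoint_def)
qed (simp add: ldisjoint_def inf_absorb1)

lemma ldisjoint_scaleR: "ldisjoint f g \<Longrightarrow> ldisjoint (s *\<^sub>R f) (t *\<^sub>R g)"
  using subspace_scale[OF subspace_ldisjoint] by (metis ldisjoint_sym mem_Collect_eq)

lemma ldisjoint_span:
  assumes "\<And>a. a \<in> A \<Longrightarrow> ldisjoint a g" "x \<in> span A"
  shows "ldisjoint x g"
  using span_minimal[OF _ subspace_ldisjoint, of A g] assms by blast

lemma ldisjoint_span_span:
  assumes "\<And>a b. a \<in> A \<Longrightarrow> b \<in> B \<Longrightarrow> ldisjoint a b" "x \<in> span A" "y \<in> span B"
  shows "ldisjoint x y"
  using ldisjoint_span[of B x y] ldisjoint_span[of A _ x] assms ldisjoint_sym by metis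

text \<open>Meeting \<open>|f| \<le> |f + g| + |g|\<close> with \<open>|f|\<close> removes the term
  \<open>|g|\<close>. The norm form of this says that projections onto disjoint components are
  contractive.\<close>

lemma labs_le_labs_add_of_ldisjoint:
  assumes "ldisjoint f g"
  shows "labs f \<le> labs (f + g)"
proof -
  have "labs f \<le> labs (f + g) + labs g"
    using labs_add_le[of "f + g" "- g"] by simp
  then have "labs f = inf (labs f) (labs (f + g) + labs g)"
    by (simp add: inf_absorb1)
  also have "\<dots> \<le> inf (labs f) (labs (f + g)) + inf (labs f) (labs g)"
    by (rule inf_add_le) auto
  also have "\<dots> \<le> labs (f + g)"
    using assms by (simp add: ldisjoint_def)
  finally show ?thesis .
qed

text \<open>A sum of disjoint nonnegative vectors is their supremum: each vector is disjoint from
  the sum of the preceding ones, and \<open>inf_plus_sup\<close> turns the sum of the two into a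
  supremum.\<close>

lemma sum_disjoint_le:
  fixes y :: "nat \<Rightarrow> 'a::{ordered_real_vector, lattice}"
  assumes "\<And>i. i < n \<Longrightarrow> 0 \<le> y i" "\<And>i. i < n \<Longrightarrow> y i \<le> h" "0 \<le> h"
    and "\<And>i j. i < n \<Longrightarrow> j < n \<Longrightarrow> i \<noteq> j \<Longrightarrow> inf (y i) (y j) = 0"
  shows "(\<Sum>i<n. y i) \<le> h"
  using assms
proof (induction n)
  case (Suc n)
  have "inf (y n) (\<Sum>i<m. y i) \<le> 0" if "m \<le> n" for m
    using that
  proof (induction m)
    case (Suc m)
    have "inf (y n) (\<Sum>i<Suc m. y i) \<le> inf (y n) (\<Sum>i<m. y i) + inf (y n) (y m)"
      using Suc.prems \<open>\<And>i. i < Suc n \<Longrightarrow> 0 \<le> y i\<close> 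
      unfolding sum.lessThan_Suc by (intro inf_add_le sum_nonneg) auto
    also have "\<dots> \<le> 0"
      using Suc \<open>\<And>i j. i < Suc n \<Longrightarrow> j < Suc n \<Longrightarrow> i \<noteq> j \<Longrightarrow> inf (y i) (y j) = 0\<close>
      by (intro add_nonpos_nonpos) auto
    finally show ?case .
  qed simp
  then have "inf (y n) (\<Sum>i<n. y i) \<le> 0"
    by blast
  then have "(\<Sum>i<Suc n. y i) \<le> sup (y n) (\<Sum>i<n. y i)"
    using inf_plus_sup[of "y n" "\<Sum>i<n. y i"]
    by (metis add.commute add_le_same_cancel2 sum.lessThan_Suc)
  also have "\<dots> \<le> h"
    using Suc by (intro sup_least Suc.IH) auto
  finally show ?case .
qed simp

text \<open>\<open>sup (- a) (inf a x)\<close> truncates \<open>x\<close> to the order interval from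
  \<open>- a\<close> to \<open>a\<close>. With the next lemma, \<open>x\<close> splits into a part
  absorbed by \<open>a\<close> and a part governed by the excess of \<open>|x|\<close> over
  \<open>a\<close>.\<close>

lemma labs_truncation_le:
  fixes x a :: "'a::{ordered_real_vector, lattice}"
  assumes "0 \<le> a"
  shows "labs (sup (- a) (inf a x)) \<le> inf (labs x) a"
proof (rule labs_least)
  have na: "- a \<le> a" "- a \<le> labs x"
    using assms by (auto intro: order_trans[of _ 0])
  then show "sup (- a) (inf a x) \<le> inf (labs x) a"
    using le_labs[of x] by (auto intro: le_infI1 le_infI2)
  have "- labs x \<le> inf a x"
    using assms neg_labs_le[of x] by (auto intro: order_trans[of _ 0])
  then have "- labs x \<le> sup (- a) (inf a x)"
    by (rule le_supI2)
  then show "- sup (- a) (inf a x) \<le> inf (labs x) a"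
    by (auto simp: minus_le_iff)
qed

lemma labs_diff_truncation_le:
  fixes x a :: "'a::{ordered_real_vector, lattice}"
  shows "labs (x - sup (- a) (inf a x)) \<le> sup (labs x - a) 0"
proof (rule labs_least)
  have "x - sup (- a) (inf a x) \<le> x - inf a x"
    by simp
  also have "\<dots> = sup (x - a) 0"
    by (simp add: diff_inf_left)
  also have "\<dots> \<le> sup (labs x - a) 0"
    by (intro sup_mono diff_right_mono le_labs order_refl)
  finally show "x - sup (- a) (inf a x) \<le> sup (labs x - a) 0" .
  have "- (x - sup (- a) (inf a x)) \<le> sup (- a) x - x"
    by (auto intro: sup_mono le_supI2)
  also have "\<dots> = sup (- x - a) 0"
    by (simp add: sup_diff_right minus_diff_commute[of a x])
  also have "\<dots> \<le> sup (labs x - a) 0"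
    by (intro sup_mono diff_right_mono neg_le_labs order_refl)
  finally show "- (x - sup (- a) (inf a x)) \<le> sup (labs x - a) 0" .
qed

section \<open>Banach lattices\<close>

lemma labs_idem: "labs (labs x) = labs x"
  by (simp add: labs_of_nonneg)

context
  assumes bl: "banach_lattice TYPE('a::{banach, ordered_real_vector, lattice})"
begin

lemma norm_labs_mono: "labs x \<le> labs y \<Longrightarrow> norm x \<le> norm (y::'a)"
  using bl by (auto simp: banach_lattice_def)

lemma norm_labs: "norm (labs x) = norm (x::'a)"
  by (intro antisym norm_labs_mono) (simp_all add: labs_idem)

lemma norm_mono: "0 \<le> x \<Longrightarrow> x \<le> y \<Longrightarrow> norm x \<le> norm (y::'a)"
  using norm_labs_mono[of x y] by (simp add: labs_of_nonneg order_trans[of 0 x y])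

lemma norm_pos_part_le: "x \<le> y \<Longrightarrow> norm (sup x 0) \<le> norm (y::'a)"
  using norm_mono[of "sup x 0" "labs y"] by (simp add: norm_labs order_trans[OF _ le_labs])

text \<open>From \<open>- l \<le> x n - l\<close>, the negative part of \<open>l\<close> has norm at
  most \<open>norm (x n - l)\<close>, which tends to 0.\<close>

lemma nonneg_LIMSEQ:
  fixes x :: "nat \<Rightarrow> 'a"
  assumes "\<And>n. 0 \<le> x n" "x \<longlonglongrightarrow> l"
  shows "0 \<le> l"
proof -
  have "norm (sup (- l) 0) \<le> norm (x n - l)" for n
    using assms(1)[of n] by (intro norm_pos_part_le) simp
  moreover have "(\<lambda>n. norm (x n - l)) \<longlonglongrightarrow> 0"
    using assms(2) by (simp add: LIM_zero tendsto_norm_zero)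
  ultimately have "norm (sup (- l) 0) \<le> 0"
    by (meson LIMSEQ_le_const)
  then have "sup (- l) 0 = 0"
    by simp
  then show ?thesis
    by (metis sup.cobounded1 neg_le_0_iff_le)
qed

lemma LIMSEQ_lattice_le:
  fixes x y :: "nat \<Rightarrow> 'a"
  assumes "\<And>n. n \<ge> N \<Longrightarrow> x n \<le> y n" "x \<longlonglongrightarrow> a" "y \<longlonglongrightarrow> b"
  shows "a \<le> b"
proof -
  have "(\<lambda>n. y (n + N) - x (n + N)) \<longlonglongrightarrow> b - a"
    using assms(2,3) by (intro tendsto_diff LIMSEQ_ignore_initial_segment)
  then have "0 \<le> b - a"
    by (rule nonneg_LIMSEQ[rotated]) (simp add: assms(1))
  then show ?thesis
    by simp
qed

text \<open>The Archimedean property follows from closedness of the cone: \<open>l\<close> is below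
  \<open>u / n\<close> for all \<open>n \<ge> 1\<close>, and these multiples tend to 0.\<close>

lemma le_0_of_scaleR_nat_le:
  fixes l u :: 'a
  assumes "\<And>n::nat. real n *\<^sub>R l \<le> u"
  shows "l \<le> 0"
proof (rule LIMSEQ_lattice_le)
  show "l \<le> (1 / real n) *\<^sub>R u" if "n \<ge> 1" for n
  proof -
    have "(1 / real n) *\<^sub>R real n *\<^sub>R l \<le> (1 / real n) *\<^sub>R u"
      by (intro scaleR_left_mono assms) auto
    then show ?thesis
      using that by simp
  qed
  have "(\<lambda>n. (1 / real n) *\<^sub>R u) \<longlonglongrightarrow> 0 *\<^sub>R u"
    by (intro tendsto_scaleR tendsto_const lim_1_over_n)
  then show "(\<lambda>n. (1 / real n) *\<^sub>R u) \<longlonglongrightarrow> 0"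
    by simp
qed auto

lemma norm_le_norm_add_of_ldisjoint: "ldisjoint f g \<Longrightarrow> norm f \<le> norm (f + (g::'a))"
  by (intro norm_labs_mono labs_le_labs_add_of_ldisjoint)

text \<open>Hahn--Banach is applied to the norm of the positive part, sublinear because the norm is
  monotone. Lying below it encodes at once positivity (it vanishes at nonpositive vectors) and norm
  at most 1.\<close>

lemma positive_norming_functional:
  fixes z :: 'a
  assumes "0 \<le> z"
  obtains \<phi> where "linear \<phi>" "\<And>x. \<phi> x \<le> norm (sup x 0)" "\<phi> z = norm z"
proof -
  have "sublinear_functional (\<lambda>x::'a. norm (sup x 0))"
    unfolding sublinear_functional_def
  proof (intro conjI allI impI)
    fix x y :: 'a
    have "norm (sup (x + y) 0) \<le> norm (sup x 0 + sup y 0)"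
      by (rule norm_mono) (auto intro: add_mono)
    then show "norm (sup (x + y) 0) \<le> norm (sup x 0) + norm (sup y 0)"
      by (rule order_trans[OF _ norm_triangle_ineq])
  next
    fix t :: real and x :: 'a assume "t > 0"
    then have "norm (sup (t *\<^sub>R x) 0) \<le> norm (t *\<^sub>R sup x 0)"
      by (intro norm_mono) (auto intro!: scaleR_left_mono scaleR_nonneg_nonneg)
    then show "norm (sup (t *\<^sub>R x) 0) \<le> t * norm (sup x 0)"
      using \<open>t > 0\<close> by simp
  qed
  then obtain \<phi> where "linear \<phi>" "\<And>x. \<phi> x \<le> norm (sup x 0)" "\<phi> z = norm (sup z 0)"
    using hahn_banach_sublinear[of "\<lambda>x::'a. norm (sup x 0)" z] by blast
  then show thesis
    using that assms by (simp add: sup_absorb1)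
qed

lemma positive_functional_mono:
  assumes "linear \<phi>" "\<And>x::'a. \<phi> x \<le> norm (sup x 0)" "x \<le> y"
  shows "\<phi> x \<le> (\<phi> y :: real)"
  using assms(2)[of "x - y"] assms(3) linear_diff[OF assms(1), of x y] by (simp add: sup_absorb2)

lemma positive_functional_bounded:
  assumes "linear \<phi>" "\<And>x::'a. \<phi> x \<le> norm (sup x 0)"
  shows "bounded_linear (\<phi> :: 'a \<Rightarrow> real)"
proof (intro bounded_linear_intro)
  show "norm (\<phi> x) \<le> norm x * 1" for x
    using assms(2)[of x] assms(2)[of "- x"] linear_neg[OF assms(1), of x]
      norm_pos_part_le[of x x] norm_pos_part_le[of "- x" "- x"] by (auto simp: abs_real_def)
qed (auto simp: linear_add[OF assms(1)] linear_scale[OF assms(1)])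

end

section \<open>Order continuity\<close>

context
  assumes bl: "banach_lattice TYPE('a::{banach, ordered_real_vector, lattice})"
    and oc: "order_continuous TYPE('a)"
begin

text \<open>The set of differences \<open>u - s n\<close>, with \<open>u\<close> an upper bound of \<open>s\<close>, decreases to \<open>0\<close> because
  the order is Archimedean; no supremum of \<open>s\<close> has to exist beforehand.\<close>

lemma order_bounded_incseq_LIMSEQ:
  fixes s :: "nat \<Rightarrow> 'a"
  assumes inc: "\<And>n. s n \<le> s (Suc n)" and bdd: "\<And>n. s n \<le> h"
  obtains l where "s \<longlonglongrightarrow> l" "\<And>n. s n \<le> l" "\<And>u. (\<And>n. s n \<le> u) \<Longrightarrow> l \<le> u"
proof -
  have mono: "s m \<le> s n" if "m \<le> n" for m n
    using lift_Suc_mono_le[of s, OF inc that] .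
  define U where "U = {u. \<forall>n. s n \<le> u}"
  define D where "D = {u - s n |u n. u \<in> U}"
  have infi: "inf u v \<in> U" if "u \<in> U" "v \<in> U" for u v
    using that by (auto simp: U_def)
  have "(INF d\<in>D. norm d) = 0"
  proof (rule oc[unfolded order_continuous_def, rule_format], intro conjI ballI allI impI)
    show "D \<noteq> {}"
      using bdd by (auto simp: D_def U_def)
    fix x assume "x \<in> D"
    then obtain u n where x: "x = u - s n" "u \<in> U"
      by (auto simp: D_def)
    then show "0 \<le> x"
      by (auto simp: U_def)
    fix y assume "y \<in> D"
    then obtain v m where y: "y = v - s m" "v \<in> U"
      by (auto simp: D_def)
    have "inf u v - s (max m n) \<le> x" "inf u v - s (max m n) \<le> y"
      using mono by (auto simp: x y intro!: diff_mono)
    then show "\<exists>z\<in>D. z \<le> x \<and> z \<le> y"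
      using infi[OF x(2) y(2)] by (auto simp: D_def)
  next
    fix l assume l: "\<forall>d\<in>D. l \<le> d"
    \<comment> \<open>A lower bound \<open>l\<close> of \<open>D\<close> can be subtracted from any
      upper bound of \<open>s\<close>. Iterating from \<open>h\<close> bounds all multiples of
      \<open>l\<close>, and the Archimedean property applies.\<close>
    have step: "u - l \<in> U" if "u \<in> U" for u
    proof -
      have "l \<le> u - s n" for n
        using l that by (auto simp: D_def)
      then have "s n \<le> u - l" for n
        by (simp add: le_diff_eq add.commute)
      then show ?thesis
        by (simp add: U_def)
    qed
    have "h - real n *\<^sub>R l \<in> U" for n
    proof (induction n)
      case (Suc n)
      have "h - real (Suc n) *\<^sub>R l = (h - real n *\<^sub>R l) - l"
        by (simp add: algebra_simps)
      then show ?case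
        using step[OF Suc] by (simp only:)
    qed (use bdd in \<open>simp add: U_def\<close>)
    then have "s 0 \<le> h - real n *\<^sub>R l" for n
      by (simp add: U_def)
    then have "real n *\<^sub>R l \<le> h - s 0" for n
      by (simp only: le_diff_eq add.commute)
    then show "l \<le> 0"
      by (rule le_0_of_scaleR_nat_le[OF bl])
  qed
  \<comment> \<open>A single element \<open>u - s N\<close> of small norm controls all later
    increments, which lie between 0 and it.\<close>
  have "Cauchy s"
  proof (rule CauchyI')
    fix e :: real assume "e > 0"
    moreover have "D \<noteq> {}"
      using bdd by (auto simp: D_def U_def)
    ultimately have "\<exists>d\<in>D. norm d < e"
      using \<open>(INF d\<in>D. norm d) = 0\<close> cInf_lessD[of "norm ` D" e] by auto
    then obtain u N where u: "u \<in> U" "norm (u - s N) < e"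
      by (auto simp: D_def)
    have "norm (s m - s n) < e" if "m \<ge> N" "n > m" for m n
    proof -
      have "s n - s m \<le> u - s N"
        using u(1) mono[OF that(1)] by (intro diff_mono) (auto simp: U_def)
      then have "norm (s n - s m) \<le> norm (u - s N)"
        using mono[of m n] that(2) by (intro norm_mono[OF bl]) auto
      then show ?thesis
        using u(2) by (simp add: norm_minus_commute)
    qed
    then show "\<exists>M. \<forall>m\<ge>M. \<forall>n>m. dist (s m) (s n) < e"
      unfolding dist_norm by blast
  qed
  then obtain l where l: "s \<longlonglongrightarrow> l"
    by (auto simp: Cauchy_convergent_iff convergent_def)
  moreover have "s n \<le> l" for n
    by (rule LIMSEQ_lattice_le[OF bl _ tendsto_const l, of n]) (rule mono)
  moreover have "l \<le> u" if "\<And>n. s n \<le> u" for u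
    by (rule LIMSEQ_lattice_le[OF bl _ l tendsto_const]) (rule that)
  ultimately show thesis
    by (rule that)
qed

text \<open>By disjointness the partial sums stay below \<open>h\<close>, so the series converges in
  norm and its terms vanish.\<close>

lemma order_bounded_disjoint_tendsto_0:
  fixes y :: "nat \<Rightarrow> 'a"
  assumes "\<And>n. 0 \<le> y n" "\<And>n. y n \<le> h" "\<And>i j. i \<noteq> j \<Longrightarrow> inf (y i) (y j) = 0"
  shows "y \<longlonglongrightarrow> 0"
proof -
  have "0 \<le> h"
    using assms order_trans by blast
  then have sum_le: "(\<Sum>i<n. y i) \<le> h" for n
    using assms by (intro sum_disjoint_le) auto
  obtain l where l: "(\<lambda>n. \<Sum>i<n. y i) \<longlonglongrightarrow> l"
    by (rule order_bounded_incseq_LIMSEQ[of "\<lambda>n. \<Sum>i<n. y i" h]) (auto simp: assms(1) sum_le)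
  then have "y sums l"
    by (simp add: sums_def)
  then show ?thesis
    by (intro summable_LIMSEQ_zero) (rule sums_summable)
qed

text \<open>The finite suprema increase to the least upper bound in norm, and each is below the
  corresponding partial sum. Hence positive functionals are countably subadditive on the supremum,
  which is the last conclusion.\<close>

lemma order_bounded_seq_lub:
  fixes y :: "nat \<Rightarrow> 'a"
  assumes "\<And>n. 0 \<le> y n" "\<And>n. y n \<le> h"
  obtains s where "\<And>n. y n \<le> s" "\<And>u. (\<And>n. y n \<le> u) \<Longrightarrow> s \<le> u"
    "\<And>\<phi> b. linear \<phi> \<Longrightarrow> (\<And>x::'a. \<phi> x \<le> norm (sup x 0)) \<Longrightarrow> (\<And>n. (\<Sum>i\<le>n. \<phi> (y i)) \<le> b) \<Longrightarrow> \<phi> s \<le> b"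
proof -
  define S where "S = rec_nat (y 0) (\<lambda>n x. sup x (y (Suc n)))"
  have S: "S 0 = y 0" "\<And>n. S (Suc n) = sup (S n) (y (Suc n))"
    by (simp_all add: S_def)
  have least: "S n \<le> u" if "\<And>n. y n \<le> u" for u n
    by (induction n) (use that in \<open>auto simp: S\<close>)
  have upper: "y n \<le> S n" for n
    by (cases n) (auto simp: S)
  have le_sum: "S n \<le> (\<Sum>i\<le>n. y i)" for n
  proof (induction n)
    case (Suc n)
    then show ?case
      using assms(1) by (auto simp: S intro: sum_nonneg add_increasing add_increasing2)
  qed (simp add: S)
  obtain s where s: "S \<longlonglongrightarrow> s" "\<And>n. S n \<le> s" "\<And>u. (\<And>n. S n \<le> u) \<Longrightarrow> s \<le> u"
    using order_bounded_incseq_LIMSEQ[of S h] least assms(2) by (auto simp: S)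
  show thesis
  proof (rule that)
    show "y n \<le> s" for n
      using upper s(2) order_trans by blast
    show "s \<le> u" if "\<And>n. y n \<le> u" for u
      using s(3) least[OF that] by blast
    fix \<phi> and b :: real
    assume \<phi>: "linear \<phi>" "\<And>x::'a. \<phi> x \<le> norm (sup x 0)" "\<And>n. (\<Sum>i\<le>n. \<phi> (y i)) \<le> b"
    have "\<phi> (S n) \<le> b" for n
      using positive_functional_mono[OF bl \<phi>(1,2) le_sum[of n]] \<phi>(3)[of n]
      by (simp add: linear_sum[OF \<phi>(1)])
    moreover have "(\<lambda>n. \<phi> (S n)) \<longlonglongrightarrow> \<phi> s"
      using positive_functional_bounded[OF bl \<phi>(1,2)] s(1) by (rule bounded_linear.tendsto)
    ultimately show "\<phi> s \<le> b"
      by (meson LIMSEQ_le_const2)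
  qed
qed

end

section \<open>Disjoint vectors in order intervals and the Kadec--Pelczynski construction\<close>

context
  assumes bl: "banach_lattice TYPE('a::{banach, ordered_real_vector, lattice})"
    and oc: "order_continuous TYPE('a)"
begin

text \<open>If the claim failed, disjointness would give vectors \<open>y n\<close> in \<open>[0,h]\<close> of norm at least \<open>\<epsilon>\<close> that
  are small on the norming functionals of all their predecessors. The order limit superior \<open>z\<close> of the
  \<open>y n\<close> is then annihilated by all these functionals, although it is the norm limit of the suprema
  \<open>s m\<close> of \<open>{y j | j \<ge> m}\<close>, on which the functional of \<open>y m\<close> is at least \<open>\<epsilon>\<close>.\<close>

lemma uniformly_exhaustive:
  fixes h :: 'a
  assumes "0 \<le> h" "0 < \<epsilon>"
  obtains N :: nat where
    "\<And>x. (\<And>i. i < N \<Longrightarrow> 0 \<le> x i \<and> x i \<le> h) \<Longrightarrow>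
      (\<And>i j. i < N \<Longrightarrow> j < N \<Longrightarrow> i \<noteq> j \<Longrightarrow> inf (x i) (x j) = 0) \<Longrightarrow> \<exists>i<N. norm (x i) < \<epsilon>"
proof (rule ccontr)
  assume "\<not> thesis"
  have ex: "\<exists>x. (\<forall>i<N. 0 \<le> x i \<and> x i \<le> h \<and> \<epsilon> \<le> norm (x i)) \<and>
      (\<forall>i<N. \<forall>j<N. i \<noteq> j \<longrightarrow> inf (x i) (x j) = 0)" for N :: nat
  proof (rule ccontr)
    assume neg: "\<not> ?thesis"
    have thesis
    proof (rule that[of N])
      fix x :: "nat \<Rightarrow> 'a"
      assume x: "\<And>i. i < N \<Longrightarrow> 0 \<le> x i \<and> x i \<le> h"
        "\<And>i j. i < N \<Longrightarrow> j < N \<Longrightarrow> i \<noteq> j \<Longrightarrow> inf (x i) (x j) = 0"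
      show "\<exists>i<N. norm (x i) < \<epsilon>"
      proof (rule ccontr)
        assume "\<not> ?thesis"
        then have "\<forall>i<N. \<epsilon> \<le> norm (x i)"
          using leI by blast
        then show False
          using neg[simplified not_ex, THEN spec, of x] x by simp
      qed
    qed
    then show False
      using \<open>\<not> thesis\<close> by contradiction
  qed
  \<comment> \<open>A pair consists of a vector and a positive functional norming it. The bounds
    \<open>(1 / 2) ^ n\<close> are summable, so they survive passing to suprema of tails.\<close>
  define P where "P F n p \<longleftrightarrow> 0 \<le> fst p \<and> fst p \<le> h \<and> \<epsilon> \<le> norm (fst p) \<and> linear (snd p) \<and>
      (\<forall>x. snd p x \<le> norm (sup x 0)) \<and> snd p (fst p) = norm (fst p) \<and>
      (\<forall>i<n. snd (F i) (fst p) \<le> (1 / 2) ^ n)"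
    for F :: "nat \<Rightarrow> 'a \<times> ('a \<Rightarrow> real)" and n and p :: "'a \<times> ('a \<Rightarrow> real)"
  have "\<exists>F. \<forall>n. P F n (F n)"
  proof (rule dependent_wellorder_choice)
    show "P F n r = P G n r" if "\<And>m. m < n \<Longrightarrow> F m = G m" for F G n r
      using that by (simp add: P_def)
    fix n F assume prev: "\<And>i. i < n \<Longrightarrow> P F i (F i)"
    define \<Phi> where "\<Phi> = (\<lambda>x. \<Sum>i<n. snd (F i) x)"
    have lin: "linear \<Phi>"
      unfolding \<Phi>_def using prev by (intro linear_compose_sum) (auto simp: P_def)
    have mono: "snd (F i) x \<le> snd (F i) y" if "i < n" "x \<le> y" for i x y
      using prev[OF that(1)] that(2) by (auto simp: P_def intro: positive_functional_mono[OF bl])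
    have nonneg: "0 \<le> snd (F i) x" if "i < n" "0 \<le> x" for i x
      using mono[OF that] linear_0[of "snd (F i)"] prev[OF that(1)] by (simp add: P_def)
    \<comment> \<open>If \<open>\<Phi>\<close> exceeded \<open>(1 / 2) ^ n\<close> on each of
      \<open>N\<close> disjoint vectors of the interval, their sum would lie below \<open>h\<close>
      and yet have a value of \<open>\<Phi>\<close> above \<open>\<Phi> h\<close>.\<close>
    obtain N where N: "\<Phi> h < real N * (1 / 2) ^ n"
      using reals_Archimedean3[of "(1 / 2) ^ n"] by auto
    obtain x where x: "\<And>i. i < N \<Longrightarrow> 0 \<le> x i \<and> x i \<le> h \<and> \<epsilon> \<le> norm (x i)"
        "\<And>i j. i < N \<Longrightarrow> j < N \<Longrightarrow> i \<noteq> j \<Longrightarrow> inf (x i) (x j) = 0"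
      using ex[of N] by blast
    have "\<exists>k<N. \<Phi> (x k) \<le> (1 / 2) ^ n"
    proof (rule ccontr)
      assume "\<not> ?thesis"
      then have "real N * (1 / 2) ^ n \<le> (\<Sum>k<N. \<Phi> (x k))"
        using sum_bounded_below[of "{..<N}" "(1 / 2) ^ n" "\<lambda>k. \<Phi> (x k)"] by force
      also have "\<dots> = \<Phi> (\<Sum>k<N. x k)"
        by (simp add: linear_sum[OF lin])
      also have "\<dots> \<le> \<Phi> h"
        unfolding \<Phi>_def using x assms(1) by (intro sum_mono mono sum_disjoint_le) auto
      finally show False
        using N by simp
    qed
    then obtain k where k: "k < N" "\<Phi> (x k) \<le> (1 / 2) ^ n"
      by blast
    have "snd (F i) (x k) \<le> (1 / 2) ^ n" if "i < n" for i
    proof -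
      have "snd (F i) (x k) \<le> \<Phi> (x k)"
        unfolding \<Phi>_def using that x(1)[OF k(1)] nonneg by (intro member_le_sum) auto
      then show ?thesis
        using k(2) by simp
    qed
    moreover obtain \<phi> where "linear \<phi>" "\<And>y. \<phi> y \<le> norm (sup y 0)" "\<phi> (x k) = norm (x k)"
      using positive_norming_functional[OF bl, of "x k"] x(1)[OF k(1)] by blast
    ultimately have "P F n (x k, \<phi>)"
      using x(1)[OF k(1)] by (simp add: P_def)
    then show "\<exists>p. P F n p" ..
  qed
  then obtain F where F: "\<And>n. P F n (F n)"
    by blast
  define y where "y n = fst (F n)" for n
  define \<phi> where "\<phi> n = snd (F n)" for n
  have y: "0 \<le> y n" "y n \<le> h" "\<epsilon> \<le> norm (y n)"
    and \<phi>: "linear (\<phi> n)" "\<phi> n x \<le> norm (sup x 0)" "\<phi> n (y n) = norm (y n)"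
    and small: "i < n \<Longrightarrow> \<phi> i (y n) \<le> (1 / 2) ^ n" for n i x
    using F[of n] by (auto simp: P_def y_def \<phi>_def)
  \<comment> \<open>The witness is the supremum of the tail from \<open>m\<close> on; the geometric
    series starting at \<open>m\<close> produces the factor 2.\<close>
  have "\<exists>s. (\<forall>n. y (m + n) \<le> s) \<and> (\<forall>u. (\<forall>n. y (m + n) \<le> u) \<longrightarrow> s \<le> u) \<and>
      (\<forall>i<m. \<phi> i s \<le> 2 * (1 / 2) ^ m)" for m
  proof (rule order_bounded_seq_lub[OF bl oc, of "\<lambda>n. y (m + n)" h])
    fix s
    assume s: "\<And>n. y (m + n) \<le> s" "\<And>u. (\<And>n. y (m + n) \<le> u) \<Longrightarrow> s \<le> u"
      "\<And>\<phi> b. linear \<phi> \<Longrightarrow> (\<And>x::'a. \<phi> x \<le> norm (sup x 0)) \<Longrightarrow>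
        (\<And>n. (\<Sum>i\<le>n. \<phi> (y (m + i))) \<le> b) \<Longrightarrow> \<phi> s \<le> b"
    have "\<phi> i s \<le> 2 * (1 / 2) ^ m" if "i < m" for i
    proof (rule s(3)[OF \<phi>(1,2)])
      fix n
      have "(\<Sum>j\<le>n. \<phi> i (y (m + j))) \<le> (\<Sum>j\<le>n. (1 / 2) ^ (m + j))"
        using that by (intro sum_mono small) auto
      also have "\<dots> = (1 / 2) ^ m * (\<Sum>j\<le>n. (1 / 2) ^ j)"
        by (simp add: power_add sum_distrib_left)
      also have "(\<Sum>j\<le>n. (1 / 2) ^ j) \<le> (2::real)"
        by (simp add: lessThan_Suc_atMost[symmetric] sum_gp_strict del: sum.lessThan_Suc)
      finally show "(\<Sum>j\<le>n. \<phi> i (y (m + j))) \<le> 2 * (1 / 2) ^ m"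
        by (simp add: mult.commute)
    qed
    then show ?thesis
      using s(1,2) by blast
  qed (rule y)+
  then obtain s where s: "\<And>m n. y (m + n) \<le> s m" "\<And>m u. (\<And>n. y (m + n) \<le> u) \<Longrightarrow> s m \<le> u"
    "\<And>i m. i < m \<Longrightarrow> \<phi> i (s m) \<le> 2 * (1 / 2) ^ m"
    by metis
  have "s (Suc m) \<le> s m" for m
    using s(1)[of m "Suc _"] by (intro s(2)) simp
  moreover have s0: "0 \<le> s m" for m
    using y(1) s(1)[of m 0] order_trans by auto
  \<comment> \<open>The tail suprema decrease, so convergence of increasing sequences is applied to
    \<open>h - s m\<close>.\<close>
  ultimately obtain l where l: "(\<lambda>m. h - s m) \<longlonglongrightarrow> l"
    by (rule_tac order_bounded_incseq_LIMSEQ[OF bl oc, of "\<lambda>m. h - s m" h]) auto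
  define z where "z = h - l"
  have z: "s \<longlonglongrightarrow> z"
    using tendsto_diff[OF tendsto_const[of h] l] by (simp add: z_def)
  have bnd: "bounded_linear (\<phi> i)" for i
    using \<phi>(1,2) by (rule positive_functional_bounded[OF bl])
  have "\<phi> i z \<le> 0" for i
  proof (rule LIMSEQ_le)
    show "(\<lambda>m. \<phi> i (s m)) \<longlonglongrightarrow> \<phi> i z"
      using bnd z by (rule bounded_linear.tendsto)
    show "(\<lambda>m. 2 * (1 / 2) ^ m) \<longlonglongrightarrow> (0::real)"
      by (intro tendsto_mult_right_zero LIMSEQ_power_zero) simp
    show "\<exists>N. \<forall>n\<ge>N. \<phi> i (s n) \<le> 2 * (1 / 2) ^ n"
      using s(3) by (intro exI[of _ "Suc i"]) auto
  qed
  moreover have "\<epsilon> \<le> \<phi> m (s m)" for m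
    using y(3)[of m] \<phi>(3)[of m] positive_functional_mono[OF bl \<phi>(1,2), of "y m" "s m" m] s(1)[of m 0]
    by simp
  ultimately have "\<epsilon> \<le> \<phi> m (s m - z)" for m
    by (simp add: linear_diff[OF \<phi>(1)]) (smt (verit))
  also have "\<phi> m (s m - z) \<le> norm (s m - z)" for m
    using \<phi>(2)[of m "s m - z"] norm_pos_part_le[OF bl, of "s m - z" "s m - z"] by simp
  finally have "\<epsilon> \<le> norm (s m - z)" for m .
  then have "\<epsilon> \<le> norm (z - z)"
    by (intro LIMSEQ_le_const[OF tendsto_norm[OF tendsto_diff[OF z tendsto_const]]]) auto
  then show False
    using assms(2) by simp
qed

end

section \<open>Making almost disjoint sequences disjoint\<close>

context
  assumes bl: "banach_lattice TYPE('a::{banach, ordered_real_vector, lattice})"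
begin

text \<open>For \<open>n < m\<close> the threshold \<open>a n\<close> dominates \<open>|x m| / 4 ^ m\<close> while \<open>a m\<close> dominates \<open>4 ^ m |x n|\<close>; hence
  \<open>(|x n| - a n)\<^sup>+\<close> and \<open>(|x m| - a m)\<^sup>+\<close> are disjoint.\<close>

lemma almost_disjoint_seq_perturbation:
  fixes x :: "nat \<Rightarrow> 'a"
  assumes norm: "\<And>n. norm (x n) = 1"
    and small: "\<And>n. norm (inf (labs (x n)) (4 ^ n *\<^sub>R (\<Sum>i<n. labs (x i)))) < (1 / 2) ^ n"
  obtains d where "disjoint_seq d" "\<And>n. norm (x n - d n) \<le> 2 * (1 / 2) ^ n"
proof -
  \<comment> \<open>All strictly later moduli enter, with weights making the series absolutely
    convergent and its norm at most \<open>(1 / 2) ^ n\<close>.\<close>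
  define t where "t n = (\<Sum>j. (1 / 4) ^ (n + Suc j) *\<^sub>R labs (x (n + Suc j)))" for n
  have norms: "summable (\<lambda>j. norm ((1 / 4) ^ (n + Suc j) *\<^sub>R labs (x (n + Suc j))))"
      "(\<Sum>j. norm ((1 / 4) ^ (n + Suc j) *\<^sub>R labs (x (n + Suc j)))) \<le> (1 / 2) ^ n" for n
  proof -
    have eq: "norm ((1 / 4) ^ (n + Suc j) *\<^sub>R labs (x (n + Suc j))) = (1 / 4) ^ Suc n * (1 / 4) ^ j" for j
      by (simp add: norm_labs[OF bl] norm power_add)
    have "(\<lambda>j. (1 / 4) ^ Suc n * (1 / 4) ^ j) sums ((1 / 4) ^ Suc n * (1 / (1 - 1 / 4 :: real)))"
      by (intro sums_mult geometric_sums) simp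
    moreover have "(1 / 4) ^ Suc n * (1 / (1 - 1 / 4)) = ((1 / 4) ^ n / 3 :: real)"
      by simp
    moreover have "(1 / 4) ^ n / 3 \<le> ((1 / 2) ^ n :: real)"
      using power_mono[of "1 / 4" "1 / 2 :: real" n] zero_le_power[of "1 / 4 :: real" n] by linarith
    ultimately show "summable (\<lambda>j. norm ((1 / 4) ^ (n + Suc j) *\<^sub>R labs (x (n + Suc j))))"
      "(\<Sum>j. norm ((1 / 4) ^ (n + Suc j) *\<^sub>R labs (x (n + Suc j)))) \<le> (1 / 2) ^ n"
      unfolding eq by (auto simp: sums_iff)
  qed
  have norm_t: "norm (t n) \<le> (1 / 2) ^ n" for n
    unfolding t_def using summable_norm[OF norms(1)] norms(2) by (rule order_trans)
  have lim: "(\<lambda>k. \<Sum>j<k. (1 / 4) ^ (n + Suc j) *\<^sub>R labs (x (n + Suc j))) \<longlonglongrightarrow> t n" for n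
    unfolding t_def using summable_norm_cancel[OF norms(1)] by (rule summable_LIMSEQ)
  have t_ge: "(1 / 4) ^ m *\<^sub>R labs (x m) \<le> t n" if nm: "n < m" for n m
  proof (rule LIMSEQ_lattice_le[OF bl _ tendsto_const lim])
    fix k assume k: "k \<ge> m - n"
    obtain j where j: "m = n + Suc j"
      using nm less_iff_Suc_add[of n m] by auto
    show "(1 / 4) ^ m *\<^sub>R labs (x m) \<le> (\<Sum>j<k. (1 / 4) ^ (n + Suc j) *\<^sub>R labs (x (n + Suc j)))"
      using sum_mono2[of "{..<k}" "{j}" "\<lambda>j. (1 / 4) ^ (n + Suc j) *\<^sub>R labs (x (n + Suc j))"] k
      by (simp add: j scaleR_nonneg_nonneg)
  qed
  have t0: "0 \<le> t n" for n
    by (rule nonneg_LIMSEQ[OF bl _ lim]) (auto intro!: sum_nonneg scaleR_nonneg_nonneg)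
  define b where "b n = 4 ^ n *\<^sub>R (\<Sum>i<n. labs (x i))" for n
  have b0: "0 \<le> b n" for n
    by (auto simp: b_def intro!: scaleR_nonneg_nonneg sum_nonneg)
  \<comment> \<open>The threshold combines the earlier terms in \<open>b n\<close> with the later
    ones in \<open>t n\<close>; \<open>d n\<close> is what remains of \<open>x n\<close> after
    truncation at \<open>a n\<close>.\<close>
  define a where "a n = b n + t n" for n
  have a0: "0 \<le> a n" for n
    using b0 t0 by (simp add: a_def)
  define d where "d n = x n - sup (- a n) (inf (a n) (x n))" for n
  have disj: "ldisjoint (d n) (d m)" if "n < m" for n m
  proof -
    have "(1 / 4) ^ m *\<^sub>R labs (x m) \<le> a n"
      using t_ge[OF that] b0[of n] by (simp add: a_def add_increasing)
    then have "labs (d n) \<le> sup (labs (x n) - (1 / 4) ^ m *\<^sub>R labs (x m)) 0"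
      unfolding d_def by (intro order_trans[OF labs_diff_truncation_le] sup_mono diff_left_mono order_refl)
    moreover have "labs (x n) \<le> (\<Sum>i<m. labs (x i))"
      using that sum_mono2[of "{..<m}" "{n}" "\<lambda>i. labs (x i)"] by simp
    then have "4 ^ m *\<^sub>R labs (x n) \<le> a m"
      using t0[of m] by (simp add: a_def b_def add_increasing2 scaleR_left_mono)
    \<comment> \<open>\<open>4 ^ m\<close> is written as a reciprocal to match
      \<open>inf_sup_diff_scaled_eq_0\<close> with \<open>c = (1 / 4) ^ m\<close>.\<close>
    then have "labs (d m) \<le> sup (labs (x m) - (1 / (1 / 4) ^ m) *\<^sub>R labs (x n)) 0"
      unfolding d_def
      by (intro order_trans[OF labs_diff_truncation_le] sup_mono diff_left_mono order_refl)
        (simp add: power_one_over)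
    ultimately show ?thesis
      unfolding ldisjoint_def by (intro inf_eq_0_mono[OF inf_sup_diff_scaled_eq_0]) auto
  qed
  show thesis
  proof (rule that)
    show "disjoint_seq d"
      unfolding disjoint_seq_def using disj ldisjoint_sym by (metis linorder_neqE_nat)
    fix n
    \<comment> \<open>The difference is the truncated part, so it is below the meet of
      \<open>|x n|\<close> with \<open>a n\<close>; the share of \<open>b n\<close> is small by
      hypothesis, that of \<open>t n\<close> by its norm.\<close>
    have "labs (x n - d n) \<le> inf (labs (x n)) (a n)"
      using labs_truncation_le[OF a0[of n]] by (simp add: d_def)
    also have "\<dots> \<le> inf (labs (x n)) (b n) + inf (labs (x n)) (t n)"
      unfolding a_def using b0 t0 by (intro inf_add_le) auto
    finally have "norm (labs (x n - d n)) \<le> norm (inf (labs (x n)) (b n) + inf (labs (x n)) (t n))"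
      by (intro norm_mono[OF bl]) auto
    also have "\<dots> \<le> norm (inf (labs (x n)) (b n)) + norm (inf (labs (x n)) (t n))"
      by (rule norm_triangle_ineq)
    also have "norm (inf (labs (x n)) (t n)) \<le> norm (t n)"
      using t0 by (intro norm_mono[OF bl]) auto
    finally show "norm (x n - d n) \<le> 2 * (1 / 2) ^ n"
      using small[of n] norm_t[of n] by (simp add: norm_labs[OF bl] b_def)
  qed
qed

text \<open>Vectors are chosen recursively, each almost disjoint from a large multiple of the sum of
  its predecessors. Perturbing them to a disjoint sequence and normalising keeps the images
  null.\<close>

lemma ex_disjoint_seq_vanishing:
  fixes T :: "'a \<Rightarrow> 'b::real_normed_vector"
  assumes T: "bounded_linear T"
    and small: "\<And>h \<epsilon>. 0 \<le> h \<Longrightarrow> 0 < \<epsilon> \<Longrightarrow>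
      \<exists>x. norm x = 1 \<and> norm (inf (labs x) h) < \<epsilon> \<and> norm (T x) < \<epsilon>"
  obtains g where "disjoint_seq g" "\<And>n. norm (g n) = 1" "(\<lambda>n. T (g n)) \<longlonglongrightarrow> 0"
proof -
  define P where "P f n x \<longleftrightarrow> norm x = 1 \<and>
      norm (inf (labs x) (4 ^ n *\<^sub>R (\<Sum>i<n. labs (f i)))) < (1 / 2) ^ n \<and> norm (T x) < (1 / 2) ^ n"
    for f :: "nat \<Rightarrow> 'a" and n x
  have "\<exists>x. \<forall>n. P x n (x n)"
  proof (rule dependent_wellorder_choice)
    show "P f n r = P g n r" if "\<And>m. m < n \<Longrightarrow> f m = g m" for f g n r
    proof -
      have "(\<Sum>i<n. labs (f i)) = (\<Sum>i<n. labs (g i))"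
        using that by (intro sum.cong) auto
      then show ?thesis
        by (simp add: P_def)
    qed
    show "\<exists>r. P f n r" for n f
      unfolding P_def by (intro small scaleR_nonneg_nonneg sum_nonneg) auto
  qed
  then obtain x where x: "\<And>n. norm (x n) = 1"
      "\<And>n. norm (inf (labs (x n)) (4 ^ n *\<^sub>R (\<Sum>i<n. labs (x i)))) < (1 / 2) ^ n"
      "\<And>n. norm (T (x n)) < (1 / 2) ^ n"
    by (auto simp: P_def)
  obtain d where d: "disjoint_seq d" "\<And>n. norm (x n - d n) \<le> 2 * (1 / 2) ^ n"
    using almost_disjoint_seq_perturbation[of x] x(1,2) by blast
  \<comment> \<open>From index 2 on, the perturbation bound \<open>2 * (1 / 2) ^ n\<close> is at
    most \<open>1 / 2\<close>; hence the shift by 2 in \<open>g\<close>.\<close>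
  have d_ge: "1 / 2 \<le> norm (d (n + 2))" for n
  proof -
    have "norm (x (n + 2) - d (n + 2)) \<le> 1 / 2"
      using d(2)[of "n + 2"] power_le_one[of "1 / 2 :: real" n] by simp
    then show ?thesis
      using norm_triangle_ineq2[of "x (n + 2)" "d (n + 2)"] x(1)[of "n + 2"] by simp
  qed
  have "(\<lambda>n. T (x n) - T (x n - d n)) \<longlonglongrightarrow> 0 - T 0"
  proof (intro tendsto_diff bounded_linear.tendsto[OF T])
    show "(\<lambda>n. T (x n)) \<longlonglongrightarrow> 0"
      using x(3) by (intro Lim_null_comparison[OF _ LIMSEQ_power_zero[of "1 / 2 :: real"]])
        (auto intro!: always_eventually less_imp_le)
    have "(\<lambda>n. 2 * (1 / 2) ^ n) \<longlonglongrightarrow> (0::real)"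
      by (intro tendsto_mult_right_zero LIMSEQ_power_zero) simp
    then show "(\<lambda>n. x n - d n) \<longlonglongrightarrow> 0"
      by (rule Lim_null_comparison[rotated]) (simp add: d(2))
  qed
  then have Td: "(\<lambda>n. T (d n)) \<longlonglongrightarrow> 0"
    by (simp add: linear_diff[OF bounded_linear.linear[OF T]] linear_0[OF bounded_linear.linear[OF T]])
  define g where "g n = (1 / norm (d (n + 2))) *\<^sub>R d (n + 2)" for n
  show thesis
  proof (rule that)
    show "disjoint_seq g"
      using d(1) by (auto simp: disjoint_seq_def g_def intro!: ldisjoint_scaleR)
    show "norm (g n) = 1" for n
      using d_ge[of n] by (auto simp: g_def)
    have le: "norm (T (g n)) \<le> 2 * norm (T (d (n + 2)))" for n
    proof -
      have "1 / norm (d (n + 2)) \<le> 2"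
        using d_ge[of n] by (subst pos_divide_le_eq) auto
      then have "(1 / norm (d (n + 2))) * norm (T (d (n + 2))) \<le> 2 * norm (T (d (n + 2)))"
        by (rule mult_right_mono) simp
      then show ?thesis
        by (simp add: g_def linear_scale[OF bounded_linear.linear[OF T]])
    qed
    have lim: "(\<lambda>n. 2 * norm (T (d (n + 2)))) \<longlonglongrightarrow> 0"
      by (intro tendsto_mult_right_zero tendsto_norm_zero LIMSEQ_ignore_initial_segment Td)
    show "(\<lambda>n. T (g n)) \<longlonglongrightarrow> 0"
      by (rule Lim_null_comparison[OF always_eventually[OF allI[OF le]] lim])
  qed
qed

end

section \<open>Strict singularity on spans of disjoint sequences\<close>

text \<open>This is exactly the condition imposed on \<open>Y\<close> in
  \<open>strictly_singular_on\<close>.\<close>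

definition infinite_dimensional :: "'a::real_vector set \<Rightarrow> bool" where
  "infinite_dimensional Y \<longleftrightarrow> (\<exists>B\<subseteq>Y. independent B \<and> infinite B)"

text \<open>Otherwise a finite maximal independent subset of \<open>Z\<close>, together with
  \<open>y0\<close>, would span \<open>Y\<close>. In the application \<open>Z\<close> has
  codimension at most one in \<open>Y\<close>.\<close>

lemma infinite_dimensional_hyperplane:
  fixes Y :: "'a::real_vector set"
  assumes Y: "infinite_dimensional Y"
    and dec: "\<And>y. y \<in> Y \<Longrightarrow> \<exists>k. y - k *\<^sub>R y0 \<in> Z"
  shows "infinite_dimensional Z"
proof (rule ccontr)
  assume Z: "\<not> infinite_dimensional Z"
  obtain B where B: "B \<subseteq> Z" "independent B" "Z \<subseteq> span B"
    using maximal_independent_subset by blast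
  have "finite B"
    using Z B by (auto simp: infinite_dimensional_def)
  have "Y \<subseteq> span (insert y0 B)"
    using dec B(3) unfolding span_insert by blast
  moreover obtain C where "C \<subseteq> Y" "independent C" "infinite C"
    using Y by (auto simp: infinite_dimensional_def)
  ultimately show False
    using independent_span_bound[of "insert y0 B" C] \<open>finite B\<close> by auto
qed

lemma subspace_closure:
  fixes S :: "'a::real_normed_vector set"
  assumes "subspace S"
  shows "subspace (closure S)"
proof (rule subspaceI)
  show "0 \<in> closure S"
    using closure_subset subspace_0[OF assms] by blast
next
  fix x y assume "x \<in> closure S" "y \<in> closure S"
  then obtain X Y where "\<And>n. X n \<in> S" "X \<longlonglongrightarrow> x" "\<And>n. Y n \<in> S" "Y \<longlonglongrightarrow> y"
    unfolding closure_sequential by blast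
  then show "x + y \<in> closure S"
    unfolding closure_sequential
    by (intro exI[of _ "\<lambda>n. X n + Y n"]) (auto intro: subspace_add[OF assms] tendsto_add)
next
  fix c x assume "x \<in> closure S"
  then obtain X where "\<And>n. X n \<in> S" "X \<longlonglongrightarrow> x"
    unfolding closure_sequential by blast
  then show "c *\<^sub>R x \<in> closure S"
    unfolding closure_sequential
    by (intro exI[of _ "\<lambda>n. c *\<^sub>R X n"]) (auto intro: subspace_scale[OF assms] tendsto_scaleR)
qed

text \<open>A linear combination involves finitely many indices; \<open>M\<close> marks where a
  vector disjoint from it may begin.\<close>

lemma span_image_initial_segment:
  fixes f :: "nat \<Rightarrow> 'a::real_vector"
  assumes "x \<in> span (f ` A)"
  obtains M where "x \<in> span (f ` (A \<inter> {..<M}))"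
proof -
  have mono: "y \<in> span (f ` (A \<inter> {..<N}))" if "y \<in> span (f ` (A \<inter> {..<M}))" "M \<le> N" for y M N
    using that span_mono[of "f ` (A \<inter> {..<M})" "f ` (A \<inter> {..<N})"] by fastforce
  have "\<exists>M. x \<in> span (f ` (A \<inter> {..<M}))"
    using assms
  proof (induction rule: span_induct_alt)
    case base
    then show ?case
      by (simp add: span_zero)
  next
    case (step c a y)
    then obtain M i where M: "y \<in> span (f ` (A \<inter> {..<M}))" and i: "i \<in> A" "a = f i"
      by auto
    have "a \<in> span (f ` (A \<inter> {..<max M (Suc i)}))"
      using i by (intro span_base) auto
    then show ?case
      using mono[OF M, of "max M (Suc i)"] by (intro exI span_add span_scale) auto
  qed
  then show thesis
    using that by blast
qed

lemma ldisjoint_span_images: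
  assumes "disjoint_seq f" "A \<inter> B = {}" "x \<in> span (f ` A)" "y \<in> span (f ` B)"
  shows "ldisjoint x y"
proof (rule ldisjoint_span_span[OF _ assms(3,4)])
  fix a b assume "a \<in> f ` A" "b \<in> f ` B"
  then obtain i j where "a = f i" "b = f j" "i \<in> A" "j \<in> B"
    by blast
  moreover from this have "i \<noteq> j"
    using assms(2) by blast
  ultimately show "ldisjoint a b"
    using assms(1) by (simp add: disjoint_seq_def)
qed

text \<open>A member in the span of the others would be disjoint from itself, hence zero.\<close>

lemma disjoint_seq_independent:
  assumes f: "disjoint_seq f" "\<And>n. f n \<noteq> 0"
  shows "independent (f ` A)" "inj f"
proof -
  show "inj f"
    using f ldisjoint_self unfolding disjoint_seq_def inj_def by metis
  have "f i \<notin> span (f ` A - {f i})" for i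
  proof
    assume "f i \<in> span (f ` A - {f i})"
    then have "f i \<in> span (f ` (A - {i}))"
      using span_mono[of "f ` A - {f i}" "f ` (A - {i})"] by blast
    then have "ldisjoint (f i) (f i)"
      using f(1) by (intro ldisjoint_span_images[of f "A - {i}" "{i}"]) (auto intro: span_base)
    then show False
      using ldisjoint_self f(2) by blast
  qed
  then show "independent (f ` A)"
    by (auto simp: dependent_def)
qed

text \<open>The span of every tail of \<open>f\<close> is infinite-dimensional, so strict
  singularity yields unit vectors there with small image. Each is taken from a tail beyond the
  indices of its predecessors, which makes the choices disjoint.\<close>

lemma not_DNS_imp_ex_disjoint_seq_vanishing:
  fixes T :: "'a::{banach, ordered_real_vector, lattice} \<Rightarrow> 'b::banach"
  assumes T: "bounded_linear T" and "\<not> DNS T"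
  obtains g where "disjoint_seq g" "\<And>n. norm (g n) = 1" "(\<lambda>n. T (g n)) \<longlonglongrightarrow> 0"
proof -
  obtain f where f: "disjoint_seq f" "\<And>n. f n \<noteq> 0"
    and sing: "strictly_singular_on (closure (span (range f))) T"
    using assms(2) by (auto simp: DNS_def)
  have small: "\<exists>y\<in>span (f ` {N..}). norm y = 1 \<and> norm (T y) < c" if "c > 0" for N :: nat and c :: real
  proof -
    let ?Y = "span (f ` {N..})"
    have "infinite (f ` {N..})"
      using finite_imageD[of f "{N..}"] disjoint_seq_independent(2)[OF f]
      by (auto simp: infinite_Ici intro: inj_on_subset)
    then have "\<exists>B\<subseteq>?Y. independent B \<and> infinite B"
      using disjoint_seq_independent(1)[OF f] span_superset by blast
    moreover have "?Y \<subseteq> closure (span (range f))"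
      using span_mono[of "f ` {N..}" "range f"] closure_subset by blast
    ultimately obtain y where y: "y \<in> ?Y" "norm (T y) < c * norm y"
      using sing[unfolded strictly_singular_on_def, rule_format, of ?Y c] \<open>c > 0\<close> by auto
    then have "norm y > 0"
      by (metis mult_zero_right norm_ge_zero norm_zero not_less zero_less_norm_iff)
    define z where "z = (1 / norm y) *\<^sub>R y"
    have "z \<in> ?Y" "norm z = 1"
      using y(1) \<open>norm y > 0\<close> by (auto simp: z_def intro: span_scale)
    moreover have "norm (T z) < c"
      using y(2) \<open>norm y > 0\<close>
      by (simp add: z_def linear_scale[OF bounded_linear.linear[OF T]] divide_simps)
    ultimately show ?thesis
      by blast
  qed
  define P where "P g n y \<longleftrightarrow> y \<in> span (range f) \<and> norm y = 1 \<and> norm (T y) < 1 / real (Suc n) \<and>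
      (\<forall>i<n. ldisjoint (g i) y)" for g :: "nat \<Rightarrow> 'a" and n y
  have "\<exists>g. \<forall>n. P g n (g n)"
  proof (rule dependent_wellorder_choice)
    show "P f n r = P g n r" if "\<And>m. m < n \<Longrightarrow> f m = g m" for f g n r
      using that by (simp add: P_def)
    fix n g assume prev: "\<And>i. i < n \<Longrightarrow> P g i (g i)"
    have "\<exists>M. g i \<in> span (f ` {..<M})" if "i < n" for i
      using prev[OF that] span_image_initial_segment[of "g i" f UNIV] by (auto simp: P_def)
    then obtain M where M: "\<And>i. i < n \<Longrightarrow> g i \<in> span (f ` {..<M i})"
      by metis
    \<comment> \<open>The inserted 0 keeps the maximum meaningful for \<open>n = 0\<close>.\<close>
    define N where "N = Max (insert 0 (M ` {..<n}))"
    have "M i \<le> N" if "i < n" for i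
      using that unfolding N_def by (intro Max_ge) auto
    then have gN: "g i \<in> span (f ` {..<N})" if "i < n" for i
      using M[OF that] that span_mono[of "f ` {..<M i}" "f ` {..<N}"] by fastforce
    obtain y where y: "y \<in> span (f ` {N..})" "norm y = 1" "norm (T y) < 1 / real (Suc n)"
      using small[of "1 / real (Suc n)" N] by auto
    have "ldisjoint (g i) y" if "i < n" for i
      by (rule ldisjoint_span_images[OF f(1) _ gN[OF that] y(1)]) auto
    then have "P g n y"
      using y span_mono[of "f ` {N..}" "range f"] by (auto simp: P_def)
    then show "\<exists>y. P g n y" ..
  qed
  then obtain g where g: "\<And>n. P g n (g n)"
    by blast
  show thesis
  proof (rule that)
    show "disjoint_seq g"
      using g ldisjoint_sym unfolding disjoint_seq_def P_def by (metis linorder_neqE_nat)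
    show "norm (g n) = 1" for n
      using g by (simp add: P_def)
    have "norm (T (g n)) \<le> 1 / real (Suc n)" for n
      using g[of n] by (simp add: P_def)
    then show "(\<lambda>n. T (g n)) \<longlonglongrightarrow> 0"
      using LIMSEQ_Suc[OF lim_1_over_n] by (rule_tac Lim_null_comparison[OF always_eventually[OF allI]])
  qed
qed

section \<open>Subspaces of the closed span of a disjoint sequence\<close>

context
  assumes bl: "banach_lattice TYPE('a::{banach, ordered_real_vector, lattice})"
begin

text \<open>By disjointness the coefficients along \<open>a\<close> of an approximating sequence are
  bounded, so a subsequence of them converges and the remainders converge along it.\<close>

lemma closure_span_insert_disjoint:
  fixes a :: 'a
  assumes disj: "\<And>s. s \<in> S \<Longrightarrow> ldisjoint s a" and a: "a \<noteq> 0"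
    and x: "x \<in> closure (span (insert a S))"
  obtains k where "x - k *\<^sub>R a \<in> closure (span S)"
proof -
  obtain X where X: "\<And>n. X n \<in> span (insert a S)" "X \<longlonglongrightarrow> x"
    using x by (auto simp: closure_sequential)
  then have "\<exists>k. X n - k *\<^sub>R a \<in> span S" for n
    by (simp add: span_breakdown_eq)
  then obtain k where k: "\<And>n. X n - k n *\<^sub>R a \<in> span S"
    by metis
  obtain K where K: "\<And>n. norm (X n) \<le> K"
    using convergent_imp_Bseq[of X] X(2) by (auto simp: convergent_def Bseq_def)
  have "\<bar>k n\<bar> * norm a \<le> K" for n
  proof -
    have "ldisjoint (X n - k n *\<^sub>R a) a"
      using disj k by (rule ldisjoint_span)
    then have "ldisjoint a (X n - k n *\<^sub>R a)"
      using ldisjoint_sym by blast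
    then have "ldisjoint (k n *\<^sub>R a) (X n - k n *\<^sub>R a)"
      using ldisjoint_scaleR[of a _ "k n" 1] by (metis scaleR_one)
    from norm_le_norm_add_of_ldisjoint[OF bl this] show ?thesis
      using K[of n] by simp
  qed
  then have "norm (k n) \<le> K / norm a" for n
    using a by (simp add: field_simps)
  then have "bounded (range k)"
    by (auto simp: bounded_iff)
  then obtain l r where r: "strict_mono r" "(k \<circ> r) \<longlonglongrightarrow> l"
    using bounded_imp_convergent_subsequence by blast
  have "(\<lambda>n. (X \<circ> r) n - (k \<circ> r) n *\<^sub>R a) \<longlonglongrightarrow> x - l *\<^sub>R a"
    by (intro tendsto_diff tendsto_scaleR tendsto_const r(2) LIMSEQ_subseq_LIMSEQ[OF X(2) r(1)])
  then have "x - l *\<^sub>R a \<in> closure (span S)"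
    unfolding closure_sequential comp_def
    by (intro exI[of _ "\<lambda>n. X (r n) - k (r n) *\<^sub>R a"]) (simp add: k)
  then show thesis
    by (rule that)
qed

lemma infinite_dimensional_tail:
  fixes f :: "nat \<Rightarrow> 'a"
  assumes f: "disjoint_seq f" "\<And>n. f n \<noteq> 0"
    and Y: "subspace Y" "infinite_dimensional Y" "Y \<subseteq> closure (span (range f))"
  shows "infinite_dimensional (Y \<inter> closure (span (f ` {N..})))"
proof (induction N)
  case 0
  have "{0::nat..} = UNIV"
    by auto
  then show ?case
    using Y by (simp add: Int_absorb2)
next
  case (Suc N)
  let ?V = "closure (span (f ` {Suc N..}))"
  have sub: "subspace ?V" "subspace (closure (span (f ` {N..})))"
    by (auto intro: subspace_closure)
  have "{N..} = insert N {Suc N..}"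
    by auto
  then have eq: "f ` {N..} = insert (f N) (f ` {Suc N..})"
    by (metis image_insert)
  have dec: "\<exists>k. y - k *\<^sub>R f N \<in> ?V" if y: "y \<in> closure (span (f ` {N..}))" for y
  proof (rule closure_span_insert_disjoint)
    show "ldisjoint s (f N)" if "s \<in> f ` {Suc N..}" for s
      using that f(1) by (auto simp: disjoint_seq_def)
    show "f N \<noteq> 0"
      by (rule f(2))
    show "y \<in> closure (span (insert (f N) (f ` {Suc N..})))"
      using y by (simp only: eq)
  qed blast
  show ?case
  proof (cases "Y \<inter> closure (span (f ` {N..})) \<subseteq> ?V")
    case True
    then have "Y \<inter> closure (span (f ` {N..})) \<subseteq> Y \<inter> ?V"
      by blast
    then show ?thesis
      using Suc unfolding infinite_dimensional_def by blast
  next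
    case False
    then obtain y0 where y0: "y0 \<in> Y" "y0 \<in> closure (span (f ` {N..}))" "y0 \<notin> ?V"
      by blast
    then obtain k0 where k0: "y0 - k0 *\<^sub>R f N \<in> ?V"
      using dec by blast
    have "k0 \<noteq> 0"
      using k0 y0(3) by auto
    show ?thesis
    proof (rule infinite_dimensional_hyperplane[OF Suc])
      fix y assume y: "y \<in> Y \<inter> closure (span (f ` {N..}))"
      then obtain k where k: "y - k *\<^sub>R f N \<in> ?V"
        using dec by blast
      \<comment> \<open>The multiple of \<open>y0\<close> is chosen to cancel the component of
        \<open>y\<close> along \<open>f N\<close>.\<close>
      have "(y - k *\<^sub>R f N) - (k / k0) *\<^sub>R (y0 - k0 *\<^sub>R f N) \<in> ?V"
        by (rule subspace_diff[OF sub(1) k subspace_scale[OF sub(1) k0]])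
      then have "y - (k / k0) *\<^sub>R y0 \<in> ?V"
        using \<open>k0 \<noteq> 0\<close> by (simp add: scaleR_right_diff_distrib)
      moreover have "y - (k / k0) *\<^sub>R y0 \<in> Y"
        using Y(1) y y0(1) by (intro subspace_diff subspace_scale) auto
      ultimately show "\<exists>c. y - c *\<^sub>R y0 \<in> Y \<inter> ?V"
        by blast
    qed
  qed
qed

text \<open>Splitting off the last vector, both its coefficient and the remainder are bounded by
  \<open>norm x\<close>, so each step adds one term to the sum.\<close>

lemma norm_image_span_disjoint_le:
  fixes f :: "nat \<Rightarrow> 'a" and T :: "'a \<Rightarrow> 'b::real_normed_vector"
  assumes T: "linear T" and f: "disjoint_seq f" "\<And>n. norm (f n) = 1"
    and "x \<in> span (f ` {N..<M})"
  shows "norm (T x) \<le> (\<Sum>i=N..<M. norm (T (f i))) * norm x"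
  using assms(4)
proof (induction M arbitrary: x)
  case 0
  then show ?case
    by (simp add: linear_0[OF T])
next
  case (Suc M)
  show ?case
  proof (cases "N \<le> M")
    case False
    then show ?thesis
      using Suc.prems by (simp add: linear_0[OF T])
  next
    case True
    then have "f ` {N..<Suc M} = insert (f M) (f ` {N..<M})"
      by (simp add: atLeastLessThanSuc)
    then obtain k where k: "x - k *\<^sub>R f M \<in> span (f ` {N..<M})"
      using Suc.prems by (auto simp: span_breakdown_eq)
    define v where "v = x - k *\<^sub>R f M"
    have x: "x = k *\<^sub>R f M + v"
      by (simp add: v_def)
    have disj: "ldisjoint v (k *\<^sub>R f M)"
      using k by (intro ldisjoint_span_images[OF f(1), of "{N..<M}" "{M}"])
        (auto simp: v_def intro: span_scale span_base)
    have "norm v \<le> norm x"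
      using norm_le_norm_add_of_ldisjoint[OF bl disj] by (simp add: x add.commute)
    moreover have "\<bar>k\<bar> \<le> norm x"
      using norm_le_norm_add_of_ldisjoint[OF bl, of "k *\<^sub>R f M" v] disj f(2)
      by (simp add: x ldisjoint_sym)
    moreover have "norm (T x) \<le> \<bar>k\<bar> * norm (T (f M)) + norm (T v)"
      using norm_triangle_ineq[of "k *\<^sub>R T (f M)" "T v"]
      by (simp add: x linear_add[OF T] linear_scale[OF T])
    moreover have "norm (T v) \<le> (\<Sum>i=N..<M. norm (T (f i))) * norm v"
      using Suc.IH k by (simp add: v_def)
    ultimately have "norm (T x) \<le> norm x * norm (T (f M)) + (\<Sum>i=N..<M. norm (T (f i))) * norm x"
      by (smt (verit) mult_left_mono mult_right_mono norm_ge_zero sum_nonneg)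
    then show ?thesis
      using True by (simp add: algebra_simps)
  qed
qed

text \<open>Along a subsequence with \<open>\<Sum>\<parallel>T (g n)\<parallel> < \<infinity>\<close>, the operator is arbitrarily small on the closed span
  of a tail, which meets every infinite-dimensional subspace of the closed span.\<close>

lemma disjoint_seq_vanishing_imp_not_DNS:
  fixes T :: "'a \<Rightarrow> 'b::banach"
  assumes T: "bounded_linear T"
    and g: "disjoint_seq g" "\<And>n. norm (g n) = 1" "(\<lambda>n. T (g n)) \<longlonglongrightarrow> 0"
  shows "\<not> DNS T"
proof
  assume "DNS T"
  have ex: "\<exists>m>k. norm (T (g m)) < (1 / 2) ^ n" for k n :: nat
  proof -
    have "eventually (\<lambda>m. norm (T (g m)) < (1 / 2) ^ n) sequentially"
      by (rule order_tendstoD(2)[OF tendsto_norm_zero[OF g(3)]]) simp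
    then have "eventually (\<lambda>m. m > k \<and> norm (T (g m)) < (1 / 2) ^ n) sequentially"
      using eventually_gt_at_top by (rule eventually_conj[rotated])
    then show ?thesis
      using eventually_happens'[OF sequentially_bot] by blast
  qed
  have "\<exists>r. \<forall>n. norm (T (g (r n))) < (1 / 2) ^ n \<and> r n < r (Suc n)"
  proof (rule dependent_nat_choice)
    show "\<exists>m. norm (T (g m)) < (1 / 2) ^ 0"
      using ex[of 0 0] by blast
    show "\<exists>l. norm (T (g l)) < (1 / 2) ^ Suc n \<and> m < l" for m n
      using ex[of m "Suc n"] by blast
  qed
  then obtain r where r: "\<And>n. norm (T (g (r n))) < (1 / 2) ^ n" "\<And>n. r n < r (Suc n)"
    by blast
  have "inj r"
    using r(2) by (simp add: strict_mono_Suc_iff strict_mono_imp_inj_on)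
  define f where "f n = g (r n)" for n
  have f: "disjoint_seq f" "\<And>n. norm (f n) = 1"
    using g \<open>inj r\<close> by (auto simp: f_def disjoint_seq_def inj_eq)
  have f0: "f n \<noteq> 0" for n
    using f(2)[of n] by auto
  have "\<not> strictly_singular_on (closure (span (range f))) T"
    using \<open>DNS T\<close> f(1) f0 by (auto simp: DNS_def)
  then obtain Y c where Y: "subspace Y" "infinite_dimensional Y" "Y \<subseteq> closure (span (range f))"
    and "c > 0" "\<not> (\<exists>y\<in>Y. norm (T y) < c * norm y)"
    unfolding strictly_singular_on_def infinite_dimensional_def by blast
  then have c: "c > 0" "\<And>y. y \<in> Y \<Longrightarrow> c * norm y \<le> norm (T y)"
    by (auto simp: not_less)
  obtain N where N: "2 * (1 / 2) ^ N < c"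
    using real_arch_pow_inv[of "c / 2" "1 / 2"] c(1) by (auto simp: field_simps)
  let ?V = "span (f ` {N..})"
  have "norm (T x) \<le> 2 * (1 / 2) ^ N * norm x" if "x \<in> ?V" for x
  proof -
    obtain M where "x \<in> span (f ` ({N..} \<inter> {..<M}))"
      using \<open>x \<in> ?V\<close> by (rule span_image_initial_segment)
    moreover have "{N..} \<inter> {..<M} = {N..<M}"
      by auto
    ultimately have "norm (T x) \<le> (\<Sum>i=N..<M. norm (T (f i))) * norm x"
      using norm_image_span_disjoint_le[OF bounded_linear.linear[OF T] f] by simp
    also have "(\<Sum>i=N..<M. norm (T (f i))) \<le> (\<Sum>i=N..<M. (1 / 2) ^ i)"
      using r(1) by (intro sum_mono) (simp add: f_def less_imp_le)
    also have "\<dots> \<le> 2 * (1 / 2) ^ N"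
    proof (cases "N \<le> M")
      case True
      \<comment> \<open>The exact identity, with its remainder term, is what the induction on
        \<open>M\<close> can carry.\<close>
      then have "(\<Sum>i=N..<M. (1 / 2) ^ i) + 2 * (1 / 2) ^ M = 2 * (1 / 2 :: real) ^ N"
        by (induction M rule: dec_induct) auto
      then show ?thesis
        using zero_le_power[of "1 / 2 :: real" M] by linarith
    qed simp
    finally show ?thesis
      by (simp add: mult_right_mono)
  qed
  \<comment> \<open>The estimate defines a closed set, so it passes from the span to its
    closure.\<close>
  moreover have "closed {x. norm (T x) \<le> 2 * (1 / 2) ^ N * norm x}"
    by (intro closed_Collect_le continuous_intros bounded_linear.continuous_on[OF T])
  ultimately have V: "norm (T x) \<le> 2 * (1 / 2) ^ N * norm x" if "x \<in> closure ?V" for x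
    using closure_minimal[of ?V "{x. norm (T x) \<le> 2 * (1 / 2) ^ N * norm x}"] that by auto
  obtain B where B: "B \<subseteq> Y \<inter> closure ?V" "independent B" "infinite B"
    using infinite_dimensional_tail[OF f(1) f0 Y, of N] by (auto simp: infinite_dimensional_def)
  obtain y where "y \<in> B"
    using B(3) by fastforce
  then have y: "y \<in> Y" "y \<in> closure ?V" "y \<noteq> 0"
    using B dependent_zero by auto
  have "c * norm y \<le> 2 * (1 / 2) ^ N * norm y"
    using c(2)[OF y(1)] V[OF y(2)] by simp
  then show False
    using N y(3) by simp
qed

end

section \<open>The equivalences\<close>

text \<open>The vectors \<open>inf (labs (f n)) h\<close> are disjoint and bounded by
  \<open>h\<close>, so order continuity makes them norm null.\<close>

lemma un_null_of_disjoint_seq: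
  fixes f :: "nat \<Rightarrow> 'a::{banach, ordered_real_vector, lattice}"
  assumes bl: "banach_lattice TYPE('a)" and oc: "order_continuous TYPE('a)"
    and f: "disjoint_seq f"
  shows "un_null f sequentially"
  unfolding un_null_def
proof (intro allI impI)
  fix h :: 'a and \<epsilon> :: real assume "0 \<le> h" "0 < \<epsilon>"
  have "(\<lambda>n. inf (labs (f n)) h) \<longlonglongrightarrow> 0"
  proof (rule order_bounded_disjoint_tendsto_0[OF bl oc, where h = h])
    show "inf (inf (labs (f i)) h) (inf (labs (f j)) h) = 0" if "i \<noteq> j" for i j
      using f that \<open>0 \<le> h\<close> unfolding disjoint_seq_def ldisjoint_def
      by (rule_tac inf_eq_0_mono[of "labs (f i)" "labs (f j)"]) auto
  qed (use \<open>0 \<le> h\<close> in auto)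
  from order_tendstoD(2)[OF tendsto_norm_zero[OF this] \<open>0 < \<epsilon>\<close>]
  show "eventually (\<lambda>n. norm (inf (labs (f n)) h) < \<epsilon>) sequentially" .
qed

text \<open>A sequence becomes a net indexed by the space itself by pushing the sequential filter
  forward along \<open>f\<close>.\<close>

lemma complements_un_imp_seq_complements_un:
  fixes T :: "'a::{banach, ordered_real_vector, lattice} \<Rightarrow> 'b::banach"
  assumes "complements_un T"
  shows "seq_complements_un T"
  unfolding seq_complements_un_def
proof
  assume "\<exists>f. (\<forall>n. norm (f n) = 1) \<and> un_null f sequentially \<and> (\<lambda>n. norm (T (f n))) \<longlonglongrightarrow> 0"
  then obtain f :: "nat \<Rightarrow> 'a" where f: "\<And>n. norm (f n) = 1" "un_null f sequentially"
      "(\<lambda>n. norm (T (f n))) \<longlonglongrightarrow> 0"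
    by blast
  \<comment> \<open>The index map is the identity on the unit sphere; the default \<open>f 0\<close>
    elsewhere gives every index a unit vector.\<close>
  define p where "p x = (if norm x = 1 then x else f 0)" for x :: 'a
  have p: "p (f n) = f n" "norm (p x) = 1" for n x
    using f(1) by (auto simp: p_def)
  have "filtermap f sequentially \<noteq> bot"
    by (simp add: filtermap_bot_iff)
  moreover have "un_null p (filtermap f sequentially)"
    using f(2) by (simp add: un_null_def eventually_filtermap p)
  moreover have "((\<lambda>x. norm (T (p x))) \<longlongrightarrow> 0) (filtermap f sequentially)"
    using f(3) by (simp add: tendsto_def eventually_filtermap p)
  ultimately show False
    using assms p(2) unfolding complements_un_def by blast
qed

theorem mainTheorem1:
  fixes T :: "'a::{banach, ordered_real_vector, lattice} \<Rightarrow> 'b::banach"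
  assumes "banach_lattice TYPE('a)"
    and "order_continuous TYPE('a)"
    and "bounded_linear T"
  shows "(DNS T \<longleftrightarrow> infDNS T)
       \<and> (DNS T \<longleftrightarrow> (\<exists>n\<ge>2. nDNS n T))
       \<and> (DNS T \<longleftrightarrow> complements_un T)
       \<and> (DNS T \<longleftrightarrow> seq_complements_un T)"
proof -
  have vanishing: "\<exists>g. disjoint_seq g \<and> (\<forall>n. norm (g n) = 1) \<and> (\<lambda>n. norm (T (g n))) \<longlonglongrightarrow> 0"
    if "\<not> DNS T"
  proof (rule not_DNS_imp_ex_disjoint_seq_vanishing[OF assms(3) that])
    fix g :: "nat \<Rightarrow> 'a"
    assume "disjoint_seq g" "\<And>n. norm (g n) = 1" "(\<lambda>n. T (g n)) \<longlonglongrightarrow> 0"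
    then show ?thesis
      using tendsto_norm_zero by blast
  qed
  have small: "\<exists>h \<epsilon>. 0 \<le> h \<and> 0 < \<epsilon> \<and> (\<forall>x. norm x = 1 \<longrightarrow> norm (inf (labs x) h) < \<epsilon> \<longrightarrow> \<epsilon> \<le> norm (T x))"
    if "DNS T"
  proof (rule ccontr)
    assume neg: "\<not> ?thesis"
    have *: "\<exists>x. norm x = 1 \<and> norm (inf (labs x) h) < \<epsilon> \<and> norm (T x) < \<epsilon>"
      if "0 \<le> h" "0 < \<epsilon>" for h \<epsilon>
    proof (rule ccontr)
      assume "\<not> ?thesis"
      then have "\<forall>x. norm x = 1 \<longrightarrow> norm (inf (labs x) h) < \<epsilon> \<longrightarrow> \<epsilon> \<le> norm (T x)"
        using leI by blast
      then show False
        using neg that by blast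
    qed
    show False
    proof (rule ex_disjoint_seq_vanishing[OF assms(1,3) *])
      fix g :: "nat \<Rightarrow> 'a"
      assume "disjoint_seq g" "\<And>n. norm (g n) = 1" "(\<lambda>n. T (g n)) \<longlonglongrightarrow> 0"
      from disjoint_seq_vanishing_imp_not_DNS[OF assms(1,3) this] show False
        using \<open>DNS T\<close> by contradiction
    qed
  qed
  have 1: "\<exists>n\<ge>2. nDNS n T" if "DNS T"
  proof -
    obtain h \<epsilon> where h: "0 \<le> h" "0 < \<epsilon>"
      and T: "\<And>x. norm x = 1 \<Longrightarrow> norm (inf (labs x) h) < \<epsilon> \<Longrightarrow> \<epsilon> \<le> norm (T x)"
      using small[OF \<open>DNS T\<close>] by blast
    obtain N :: nat where N: "\<And>x. (\<And>i. i < N \<Longrightarrow> 0 \<le> x i \<and> x i \<le> h) \<Longrightarrow>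
      (\<And>i j. i < N \<Longrightarrow> j < N \<Longrightarrow> i \<noteq> j \<Longrightarrow> inf (x i) (x j) = 0) \<Longrightarrow> \<exists>i<N. norm (x i) < \<epsilon>"
      using uniformly_exhaustive[OF assms(1,2) h] by blast
    \<comment> \<open>Among \<open>N\<close> disjoint unit vectors one has a small meet with
      \<open>h\<close>, hence an image of norm at least \<open>\<epsilon>\<close>; the constant
      \<open>\<epsilon> / 2\<close> turns this into a contradiction. The maximum secures
      \<open>n \<ge> 2\<close>.\<close>
    have "nDNS (max 2 N) T"
      unfolding nDNS_def
    proof (intro exI[of _ "\<epsilon> / 2"] conjI notI)
      show "0 < \<epsilon> / 2"
        using h by simp
      assume "\<exists>f. (\<forall>i<max 2 N. \<forall>j<max 2 N. i \<noteq> j \<longrightarrow> ldisjoint (f i) (f j)) \<and>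
        (\<forall>k<max 2 N. norm (f k) = 1 \<and> norm (T (f k)) \<le> \<epsilon> / 2)"
      then obtain f :: "nat \<Rightarrow> 'a" where
        "\<forall>i<max 2 N. \<forall>j<max 2 N. i \<noteq> j \<longrightarrow> ldisjoint (f i) (f j)"
        "\<forall>k<max 2 N. norm (f k) = 1 \<and> norm (T (f k)) \<le> \<epsilon> / 2"
        by blast
      then have f: "\<And>i j. i < N \<Longrightarrow> j < N \<Longrightarrow> i \<noteq> j \<Longrightarrow> ldisjoint (f i) (f j)"
        "\<And>k. k < N \<Longrightarrow> norm (f k) = 1 \<and> norm (T (f k)) \<le> \<epsilon> / 2"
        by simp_all
      have "\<exists>i<N. norm (inf (labs (f i)) h) < \<epsilon>"
      proof (rule N[of "\<lambda>i. inf (labs (f i)) h"])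
        show "inf (inf (labs (f i)) h) (inf (labs (f j)) h) = 0" if "i < N" "j < N" "i \<noteq> j" for i j
          using f(1)[OF that] h(1) unfolding ldisjoint_def
          by (rule_tac inf_eq_0_mono[of "labs (f i)" "labs (f j)"]) auto
      qed (use h in auto)
      then obtain i where i: "i < N" "norm (inf (labs (f i)) h) < \<epsilon>"
        by blast
      then show False
        using T[of "f i"] f(2)[OF i(1)] h(2) by simp
    qed
    then show ?thesis
      by (metis max.cobounded1)
  qed
  \<comment> \<open>Only finitely many terms of a disjoint sequence can have image of norm at most
    \<open>r\<close>, since otherwise \<open>n\<close> of them would form a forbidden tuple. The
    limit inferior is then at least \<open>r\<close>, so strictly above
    \<open>r / 2\<close>.\<close>
  have 2: "infDNS T" if "nDNS n T" for n
  proof -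
    obtain r where r: "r > 0" and nex: "\<not> (\<exists>f::nat \<Rightarrow> 'a.
        (\<forall>i<n. \<forall>j<n. i \<noteq> j \<longrightarrow> ldisjoint (f i) (f j)) \<and> (\<forall>k<n. norm (f k) = 1 \<and> norm (T (f k)) \<le> r))"
      using \<open>nDNS n T\<close> unfolding nDNS_def by blast
    show ?thesis
      unfolding infDNS_def
    proof (intro exI[of _ "r / 2"] conjI allI impI)
      show "0 < r / 2"
        using r by simp
      fix f :: "nat \<Rightarrow> 'a" assume f: "disjoint_seq f \<and> (\<forall>n. norm (f n) = 1)"
      define K where "K = {k. norm (T (f k)) \<le> r}"
      have "finite K"
      proof (rule ccontr)
        assume "infinite K"
        then have e: "enumerate K k \<in> K" "inj (enumerate K)" for k
          by (simp_all add: enumerate_in_set strict_mono_enumerate strict_mono_imp_inj_on)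
        have "ldisjoint (f (enumerate K i)) (f (enumerate K j))" if "i \<noteq> j" for i j
          using f that injD[OF e(2), of i j] by (auto simp: disjoint_seq_def)
        moreover have "norm (T (f (enumerate K k))) \<le> r" for k
          using e(1)[of k] by (simp add: K_def)
        ultimately show False
          using nex f by (auto dest!: spec[of _ "\<lambda>k. f (enumerate K k)"])
      qed
      then have "eventually (\<lambda>k. k \<notin> K) sequentially"
        by (simp add: cofinite_eq_sequentially[symmetric] eventually_cofinite)
      then have "eventually (\<lambda>k. ereal r \<le> ereal (norm (T (f k)))) sequentially"
        by eventually_elim (simp add: K_def)
      then have "ereal r \<le> liminf (\<lambda>n. ereal (norm (T (f n))))"
        by (rule Liminf_bounded)
      then show "liminf (\<lambda>n. ereal (norm (T (f n)))) > ereal (r / 2)"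
        using r(1) by (rule_tac less_le_trans[of "ereal (r / 2)" "ereal r"]) auto
    qed
  qed
  have 3: "DNS T" if "infDNS T"
  proof (rule ccontr)
    assume "\<not> DNS T"
    then obtain g where g: "disjoint_seq g" "\<And>n. norm (g n) = 1" "(\<lambda>n. norm (T (g n))) \<longlonglongrightarrow> 0"
      using vanishing by blast
    obtain r where "r > 0" "liminf (\<lambda>n. ereal (norm (T (g n)))) > ereal r"
      using \<open>infDNS T\<close> g(1,2) unfolding infDNS_def by blast
    moreover have "liminf (\<lambda>n. ereal (norm (T (g n)))) = ereal 0"
      by (rule lim_imp_Liminf[OF sequentially_bot tendsto_ereal[OF g(3)]])
    ultimately show False
      by simp
  qed
  have 4: "complements_un T" if "DNS T"
    unfolding complements_un_def
  proof
    assume "\<exists>(f::'a \<Rightarrow> 'a) F. F \<noteq> bot \<and> (\<forall>p. norm (f p) = 1) \<and> un_null f F \<and>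
      ((\<lambda>p. norm (T (f p))) \<longlongrightarrow> 0) F"
    then obtain f :: "'a \<Rightarrow> 'a" and F where F: "F \<noteq> bot" "\<And>p. norm (f p) = 1" "un_null f F"
        "((\<lambda>p. norm (T (f p))) \<longlongrightarrow> 0) F"
      by blast
    obtain h \<epsilon> where h: "0 \<le> h" "0 < \<epsilon>"
      and T: "\<And>x. norm x = 1 \<Longrightarrow> norm (inf (labs x) h) < \<epsilon> \<Longrightarrow> \<epsilon> \<le> norm (T x)"
      using small[OF \<open>DNS T\<close>] by blast
    have "eventually (\<lambda>p. norm (inf (labs (f p)) h) < \<epsilon>) F"
      using F(3) h by (simp add: un_null_def)
    moreover have "eventually (\<lambda>p. norm (T (f p)) < \<epsilon>) F"
      using order_tendstoD(2)[OF F(4) h(2)] .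
    ultimately have "eventually (\<lambda>p. False) F"
      by eventually_elim (use T[OF F(2)] not_le in blast)
    then show False
      using F(1) by (simp add: trivial_limit_def)
  qed
  have 5: "DNS T" if "seq_complements_un T"
    using that vanishing un_null_of_disjoint_seq[OF assms(1,2)] unfolding seq_complements_un_def by blast
  show ?thesis
    using 1 2 3 4 5 complements_un_imp_seq_complements_un[of T] by blast
qed

end
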